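(* Let $n\ge 1$. A $\langle \mathbb{R},+,<,\mathbb{Z}\rangle$-definable relation $X\subseteq\mathbb{R}^n$ is $\langle \mathbb{R},+,<,1\rangle$-definable if and only if the intersection of $X$ with every rational line of $\mathbb{R}^n$ is $\langle \mathbb{R},+,<,1\rangle$-definable.
   Context: Structures are one-sorted with domain $\mathbb{R}$ and formulas are first-order with equality. In $\langle \mathbb{R},+,<,\mathbb{Z}\rangle$, $\mathbb{Z}$ is a unary predicate satisfied exactly by the integers; in $\langle \mathbb{R},+,<,1\rangle$, $1$ is a constant. A relation $X\subseteq\mathbb{R}^n$ is definable in a structure $\mathcal{M}$ ($\mathcal M$-definable) if there is a formula $\varphi(x_1,\dots,x_n)$ in the signature of $\mathcal{M}$ (no parameters) such that $\varphi(a_1,\dots,a_n)$ holds in $\mathcal M$ iff $(a_1,\dots,a_n)\in X$. A line in $\mathbb{R}^n$ is rational if it is the intersection of (affine) hyperplanes defined by equations with rational coefficients. *)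

theory Defs
  imports "HOL-Analysis.Analysis"
begin

datatype 'v rtm = Var 'v | One | Add "'v rtm" "'v rtm"

text \<open>Formulas over the union of the two signatures; a single signature is singled out by
  \<open>symbols\<close> below. The remaining connectives and the universal quantifier are
  expressible as usual.\<close>

datatype 'v rfm =
    Eq "'v rtm" "'v rtm"
  | Lt "'v rtm" "'v rtm"
  | Integer "'v rtm"
  | Neg "'v rfm"
  | Conj "'v rfm" "'v rfm"
  | Ex 'v "'v rfm"

primrec tm_val :: "('v \<Rightarrow> real) \<Rightarrow> 'v rtm \<Rightarrow> real" where
  "tm_val e (Var v) = e v"
| "tm_val e One = 1"
| "tm_val e (Add s t) = tm_val e s + tm_val e t"

primrec sat :: "('v \<Rightarrow> real) \<Rightarrow> 'v rfm \<Rightarrow> bool" where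
  "sat e (Eq s t) \<longleftrightarrow> tm_val e s = tm_val e t"
| "sat e (Lt s t) \<longleftrightarrow> tm_val e s < tm_val e t"
| "sat e (Integer t) \<longleftrightarrow> tm_val e t \<in> \<int>"
| "sat e (Neg p) \<longleftrightarrow> \<not> sat e p"
| "sat e (Conj p q) \<longleftrightarrow> sat e p \<and> sat e q"
| "sat e (Ex v p) \<longleftrightarrow> (\<exists>x. sat (e(v := x)) p)"

primrec tm_vars :: "'v rtm \<Rightarrow> 'v set" where
  "tm_vars (Var v) = {v}"
| "tm_vars One = {}"
| "tm_vars (Add s t) = tm_vars s \<union> tm_vars t"

primrec free_vars :: "'v rfm \<Rightarrow> 'v set" where
  "free_vars (Eq s t) = tm_vars s \<union> tm_vars t"
| "free_vars (Lt s t) = tm_vars s \<union> tm_vars t"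
| "free_vars (Integer t) = tm_vars t"
| "free_vars (Neg p) = free_vars p"
| "free_vars (Conj p q) = free_vars p \<union> free_vars q"
| "free_vars (Ex v p) = free_vars p - {v}"

datatype symbol = Add_sym | Lt_sym | Int_sym | One_sym

primrec tm_symbols :: "'v rtm \<Rightarrow> symbol set" where
  "tm_symbols (Var v) = {}"
| "tm_symbols One = {One_sym}"
| "tm_symbols (Add s t) = {Add_sym} \<union> tm_symbols s \<union> tm_symbols t"

primrec symbols :: "'v rfm \<Rightarrow> symbol set" where
  "symbols (Eq s t) = tm_symbols s \<union> tm_symbols t"
| "symbols (Lt s t) = {Lt_sym} \<union> tm_symbols s \<union> tm_symbols t"
| "symbols (Integer t) = {Int_sym} \<union> tm_symbols t"
| "symbols (Neg p) = symbols p"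
| "symbols (Conj p q) = symbols p \<union> symbols q"
| "symbols (Ex v p) = symbols p"

text \<open>A formula in the variables \<open>x\<^sub>1, \<dots>, x\<^sub>n\<close>: \<open>Inl i\<close> is the variable for the coordinate \<open>i\<close>,
  and the variables \<open>Inr k\<close> are available for quantification only. The value \<open>w\<close> of the latter is
  irrelevant to satisfaction, since they do not occur free.\<close>

definition definable :: "symbol set \<Rightarrow> (real ^ 'n) set \<Rightarrow> bool" where
  "definable S X \<longleftrightarrow>
    (\<exists>p :: ('n + nat) rfm. symbols p \<subseteq> S \<and> free_vars p \<subseteq> range Inl \<and>
       (\<forall>a w. sat (case_sum (\<lambda>i. a $ i) w) p \<longleftrightarrow> a \<in> X))"

abbreviation RZ_definable :: "(real ^ 'n) set \<Rightarrow> bool" where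
  "RZ_definable \<equiv> definable {Add_sym, Lt_sym, Int_sym}"

abbreviation R1_definable :: "(real ^ 'n) set \<Rightarrow> bool" where
  "R1_definable \<equiv> definable {Add_sym, Lt_sym, One_sym}"

definition rational_hyperplane :: "(real ^ 'n) set \<Rightarrow> bool" where
  "rational_hyperplane H \<longleftrightarrow>
    (\<exists>a b. a \<noteq> 0 \<and> (\<forall>i. a $ i \<in> \<rat>) \<and> b \<in> \<rat> \<and> H = {x. a \<bullet> x = b})"

text \<open>The empty intersection is the whole space, so in dimension 1 the line \<open>UNIV\<close> is rational.\<close>

definition rational_line :: "(real ^ 'n) set \<Rightarrow> bool" where
  "rational_line L \<longleftrightarrow>
    affine L \<and> aff_dim L = 1 \<and> (\<exists>\<H>. (\<forall>H\<in>\<H>. rational_hyperplane H) \<and> L = \<Inter>\<H>)"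

end

theory Submission imports Defs begin

text \<open>
A back-and-forth argument over integer linear forms replaces quantifier elimination. Call two points
equivalent at scale \<open>M\<close> if every form with coefficients bounded by \<open>H\<close> takes the same value at both,
or is larger than \<open>M\<close> at both, or smaller than \<open>-M\<close> at both. A formula over \<open>+, <, \<int>\<close> cannot separate
two points that are equivalent and congruent modulo some \<open>N\<close>; every point is equivalent and congruent
to a bounded one; and a formula over \<open>+, <, 1\<close> only sees the signs of finitely many integer affine
forms. If \<open>X\<close> is tame on rational lines, the congruence can be dropped: two equivalent rational points
are joined modulo \<open>N\<close> by a ray along which \<open>X\<close> is both periodic and eventually constant, and real points are
reduced to rational ones because bounded parts of \<open>X\<close> depend only on signs of affine forms. Then
membership of \<open>a\<close> in \<open>X\<close> is membership of a bounded point equivalent to \<open>a\<close>, which again depends only on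
signs of affine forms at \<open>a\<close>.
\<close>

subsection \<open>Back and forth for integer linear forms\<close>

text \<open>The hypothesis on lines is not uniform: how far out \<open>X\<close> becomes constant
  depends on the line. This is harmless, because it serves only to show that two given points agree,
  while the bounds under which they agree come from the formula for \<open>X\<close> alone. The
  obstacle is the direction of the ray. It must annihilate every form of moderate size and push
  every large form further out, and at a prescribed scale \<open>M\<close> it may fail to exist: if
  two coordinates are at most \<open>M\<close> in size but their sum exceeds \<open>M\<close>, the
  direction would have to be zero in both and positive in the sum. So the scale is chosen for each
  point, in a range free of values of the finitely many forms, and only its upper bound
  \<open>S\<close> is uniform. Rationality of the points is used twice on the ray: for the line to
  be rational, and for a common denominator of the direction, which yields the period.\<close>

definition lin :: "'v set \<Rightarrow> ('v \<Rightarrow> int) \<Rightarrow> ('v \<Rightarrow> real) \<Rightarrow> real" where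
  "lin F c e = (\<Sum>v\<in>F. of_int (c v) * e v)"

definition small :: "nat \<Rightarrow> ('v \<Rightarrow> int) \<Rightarrow> bool" where
  "small H c \<longleftrightarrow> (\<forall>v. \<bar>c v\<bar> \<le> int H)"

lemma small_mono: "small H c \<Longrightarrow> H \<le> K \<Longrightarrow> small K c"
  unfolding small_def by (meson order_trans of_nat_mono)

lemma small_uminus: "small H c \<Longrightarrow> small H (\<lambda>v. - c v)"
  by (simp add: small_def)

lemma small_zero [simp]: "small H (\<lambda>v. 0)"
  by (simp add: small_def)

text \<open>Eliminating a variable between two forms multiplies each by the coefficient of that
  variable in the other, here \<open>j\<close> and \<open>i\<close>. This is the source of the bound
  \<open>2 * H * H\<close>, both for \<open>eqv\<close> and for \<open>sgneq\<close>.\<close>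

lemma small_comb:
  assumes "small H c" "small H d" "\<bar>i\<bar> \<le> int H" "\<bar>j\<bar> \<le> int H"
  shows "small (2 * H * H) (\<lambda>v. i * c v - j * d v)"
  unfolding small_def
proof
  fix v
  have "\<bar>i * c v\<bar> \<le> int H * int H" "\<bar>j * d v\<bar> \<le> int H * int H"
    using assms unfolding small_def abs_mult by (auto intro!: mult_mono)
  then show "\<bar>i * c v - j * d v\<bar> \<le> int (2 * H * H)"
    by (simp add: algebra_simps)
qed

lemma lin_insert:
  assumes "finite F" "v \<notin> F"
  shows "lin (insert v F) c (a(v := x)) = lin F c a + of_int (c v) * x"
proof -
  have "(\<Sum>u\<in>F. of_int (c u) * (a(v := x)) u) = (\<Sum>u\<in>F. of_int (c u) * a u)"
    using assms by (intro sum.cong) auto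
  then show ?thesis using assms by (simp add: lin_def)
qed

lemma lin_uminus: "lin F (\<lambda>v. - c v) a = - lin F c a"
  by (simp add: lin_def sum_negf)

lemma lin_zero [simp]: "lin F (\<lambda>v. 0) a = 0"
  by (simp add: lin_def)

lemma lin_comb: "lin F (\<lambda>v. i * c v - j * d v) a = of_int i * lin F c a - of_int j * lin F d a"
  by (simp add: lin_def sum_subtractf sum_distrib_left algebra_simps)

lemma lin_diff: "lin F c a - lin F c b = lin F c (\<lambda>v. a v - b v)"
  by (simp add: lin_def sum_subtractf algebra_simps)

lemma lin_add: "lin F c (\<lambda>v. a v + b v) = lin F c a + lin F c b"
  by (simp add: lin_def sum.distrib algebra_simps)

lemma lin_scale: "lin F c (\<lambda>v. t * a v) = t * lin F c a"
  by (simp add: lin_def sum_distrib_left algebra_simps)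

lemma lin_Ints: "lin F c (\<lambda>v. of_int (w v)) \<in> \<int>"
  unfolding lin_def by (intro Ints_sum) simp

lemma abs_lin_le:
  assumes "finite F" "small H c" "\<And>v. v \<in> F \<Longrightarrow> \<bar>b v\<bar> \<le> R"
  shows "\<bar>lin F c b\<bar> \<le> real (card F) * real H * R"
proof -
  have "\<bar>lin F c b\<bar> \<le> (\<Sum>v\<in>F. \<bar>of_int (c v) * b v\<bar>)"
    unfolding lin_def by (rule sum_abs)
  also have "\<dots> \<le> (\<Sum>v\<in>F. real H * R)"
  proof (rule sum_mono)
    fix v assume "v \<in> F"
    have "\<bar>c v\<bar> \<le> int H" using assms(2) by (simp add: small_def)
    then have "\<bar>real_of_int (c v)\<bar> \<le> real H" by linarith
    then show "\<bar>of_int (c v) * b v\<bar> \<le> real H * R"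
      unfolding abs_mult using assms(3)[OF \<open>v \<in> F\<close>] by (intro mult_mono) auto
  qed
  finally show ?thesis by simp
qed

text \<open>Over an infinite variable type there are infinitely many small \<open>c\<close>, but a
  form reads \<open>c\<close> on \<open>F\<close> only; setting \<open>c\<close> to zero elsewhere
  leaves finitely many.\<close>

lemma finite_lin_values:
  assumes "finite F"
  shows "finite ((\<lambda>c. lin F c b) ` {c. small H c})"
proof -
  let ?C = "{c. \<forall>v. (v \<in> F \<longrightarrow> c v \<in> {- int H..int H}) \<and> (v \<notin> F \<longrightarrow> c v = 0)}"
  have "(\<lambda>c. lin F c b) ` {c. small H c} \<subseteq> (\<lambda>c. lin F c b) ` ?C"
  proof clarify
    fix c :: "'a \<Rightarrow> int" assume "small H c"
    then have c: "\<bar>c v\<bar> \<le> int H" for v by (simp add: small_def)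
    have "(\<lambda>v. if v \<in> F then c v else 0) \<in> ?C"
      using c by (auto simp: abs_le_iff) (metis minus_le_iff)
    moreover have "lin F c b = lin F (\<lambda>v. if v \<in> F then c v else 0) b"
      by (simp add: lin_def)
    ultimately show "lin F c b \<in> (\<lambda>c. lin F c b) ` ?C" by blast
  qed
  moreover have "finite ?C"
    using finite_set_of_finite_funs[OF assms, of "{- int H..int H}" 0] by simp
  ultimately show ?thesis by (meson finite_imageI finite_subset)
qed

text \<open>Two reals agree, or cannot be told apart from \<open>\<plusminus>\<infinity>\<close> at scale \<open>M\<close>.\<close>

definition same :: "nat \<Rightarrow> real \<Rightarrow> real \<Rightarrow> bool" where
  "same M s t \<longleftrightarrow> s = t \<or> real M < s \<and> real M < t \<or> s < - real M \<and> t < - real M"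

text \<open>Forms have no constant term here. Values within \<open>[-M, M]\<close> must agree
  exactly, so the signs of \<open>lin F c a + d\<close> and \<open>lin F c b + d\<close> agree as
  well whenever \<open>d\<close> is at most \<open>M\<close> in size.\<close>

definition eqv :: "'v set \<Rightarrow> nat \<Rightarrow> nat \<Rightarrow> ('v \<Rightarrow> real) \<Rightarrow> ('v \<Rightarrow> real) \<Rightarrow> bool" where
  "eqv F H M a b \<longleftrightarrow> (\<forall>c. small H c \<longrightarrow> same M (lin F c a) (lin F c b))"

definition congr :: "'v set \<Rightarrow> nat \<Rightarrow> ('v \<Rightarrow> real) \<Rightarrow> ('v \<Rightarrow> real) \<Rightarrow> bool" where
  "congr F N a b \<longleftrightarrow> (\<forall>v\<in>F. \<exists>k::int. a v - b v = real N * of_int k)"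

lemma same_mono: "same K s t \<Longrightarrow> M \<le> K \<Longrightarrow> same M s t"
  unfolding same_def using of_nat_mono[of M K, where 'a = real] by linarith

lemma same_uminus: "same M (- s) (- t) \<longleftrightarrow> same M s t"
  unfolding same_def by auto

lemma same_sgn: "same M s t \<Longrightarrow> sgn s = sgn t"
  unfolding same_def by (auto simp: sgn_real_def)

lemma eqv_mono: "eqv F H' M' a b \<Longrightarrow> H \<le> H' \<Longrightarrow> M \<le> M' \<Longrightarrow> eqv F H M a b"
  unfolding eqv_def by (meson small_mono same_mono)

lemma eqv_refl: "eqv F H M a a"
  by (simp add: eqv_def same_def)

lemma eqv_sym: "eqv F H M a b \<Longrightarrow> eqv F H M b a"
  unfolding eqv_def same_def by metis

lemma eqv_trans: "eqv F H M a b \<Longrightarrow> eqv F H M b c \<Longrightarrow> eqv F H M a c"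
  unfolding eqv_def same_def by (smt (verit) of_nat_0_le_iff)

lemma congr_dvd:
  assumes "congr F N' a b" "N dvd N'" shows "congr F N a b"
  unfolding congr_def
proof
  fix v assume "v \<in> F"
  then obtain k :: int where "a v - b v = real N' * of_int k" using assms(1) by (auto simp: congr_def)
  moreover obtain j where "N' = N * j" using assms(2) by (auto elim: dvdE)
  ultimately have "a v - b v = real N * of_int (int j * k)" by simp
  then show "\<exists>k::int. a v - b v = real N * of_int k" by blast
qed

lemma congr_refl: "congr F N a a"
  by (auto simp: congr_def intro: exI[of _ 0])

lemma congr_lin:
  assumes "congr F N a b"
  shows "\<exists>k::int. lin F c a - lin F c b = real N * of_int k"
proof -
  obtain k :: "'a \<Rightarrow> int" where k: "\<And>v. v \<in> F \<Longrightarrow> a v - b v = real N * of_int (k v)"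
    using assms unfolding congr_def by metis
  have "lin F c a - lin F c b = (\<Sum>v\<in>F. real N * of_int (c v * k v))"
    unfolding lin_diff unfolding lin_def using k by (intro sum.cong) auto
  then have "lin F c a - lin F c b = real N * of_int (\<Sum>v\<in>F. c v * k v)"
    by (simp add: sum_distrib_left)
  then show ?thesis by blast
qed

lemma congr_insert:
  assumes "congr F N a b" "v \<notin> F" "y - x = real N * of_int (k::int)"
  shows "congr (insert v F) N (a(v := x)) (b(v := y))"
proof -
  have "x - y = real N * of_int (- k)" using assms(3) by simp
  then show ?thesis using assms(1,2) unfolding congr_def by (metis fun_upd_apply insert_iff)
qed

text \<open>Only positive coefficients of the new variable need a check: coefficient zero is the old
  equivalence, and a negative one is reduced to a positive one by negating the form.\<close>

lemma eqv_insertI: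
  assumes "finite F" "v \<notin> F" "eqv F H M a b"
    and pos: "\<And>c e. small H c \<Longrightarrow> 1 \<le> e \<Longrightarrow> e \<le> H \<Longrightarrow>
               same M (lin F c a + real e * x) (lin F c b + real e * y)"
  shows "eqv (insert v F) H M (a(v := x)) (b(v := y))"
  unfolding eqv_def
proof (intro allI impI)
  fix c :: "'a \<Rightarrow> int" assume c: "small H c"
  then have cv: "\<bar>c v\<bar> \<le> int H" by (simp add: small_def)
  consider "c v = 0" | "c v > 0" | "c v < 0" by linarith
  then have "same M (lin F c a + of_int (c v) * x) (lin F c b + of_int (c v) * y)"
  proof cases
    case 1 then show ?thesis using assms(3) c by (simp add: eqv_def)
  next
    case 2 then show ?thesis using pos[OF c, of "nat (c v)"] cv by simp
  next
    case 3 then show ?thesis using pos[OF small_uminus[OF c], of "nat (- c v)"] cv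
      by (subst same_uminus[symmetric]) (simp add: lin_uminus)
  qed
  then show "same M (lin (insert v F) c (a(v := x))) (lin (insert v F) c (b(v := y)))"
    using assms(1,2) by (simp add: lin_insert)
qed

lemma ex_shift_above:
  assumes "N \<ge> 1"
  shows "\<exists>k::int. l < x + real N * of_int k \<and> x + real N * of_int k \<le> l + real N"
proof -
  let ?k = "\<lfloor>(l - x) / real N\<rfloor> + 1"
  have N: "real N > 0" using assms by simp
  have "(l - x) / real N < of_int ?k" "of_int ?k \<le> (l - x) / real N + 1" by linarith+
  then have "l - x < real N * of_int ?k" "real N * of_int ?k \<le> l - x + real N"
    using N by (simp_all add: field_simps)
  then have "l < x + real N * of_int ?k \<and> x + real N * of_int ?k \<le> l + real N" by linarith
  then show ?thesis by blast
qed

text \<open>An interval of length \<open>N\<close> contains a representative of \<open>x\<close>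
  modulo \<open>N\<close>, and the gap between \<open>A\<close> and \<open>B\<close> is that long.
  Staying next to an element of \<open>A\<close>, or of \<open>B\<close> if \<open>A\<close> is
  empty, keeps the representative bounded.\<close>

lemma ex_shift_between:
  fixes A B :: "real set"
  assumes "N \<ge> 1" "finite A" "finite B" "A \<union> B \<noteq> {}"
    and gap: "\<And>s t. s \<in> A \<Longrightarrow> t \<in> B \<Longrightarrow> s + real N < t"
    and bound: "\<And>s. s \<in> A \<union> B \<Longrightarrow> \<bar>s\<bar> \<le> K"
  shows "\<exists>k::int. (\<forall>s\<in>A. s < x + real N * of_int k) \<and> (\<forall>t\<in>B. x + real N * of_int k < t)
           \<and> \<bar>x + real N * of_int k\<bar> \<le> K + 2 * real N"
proof (cases "A = {}")
  case True
  then have B: "B \<noteq> {}" using assms by simp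
  \<comment> \<open>Starting \<open>2 * N\<close> below \<open>Min B\<close> makes the
    representative end at least \<open>N\<close> below it, hence strictly below all of
    \<open>B\<close>.\<close>
  obtain k :: int where k: "Min B - 2 * real N < x + real N * of_int k"
      "x + real N * of_int k \<le> Min B - 2 * real N + real N"
    using ex_shift_above[OF assms(1)] by blast
  have "Min B \<in> B" using B assms by simp
  then have "\<bar>Min B\<bar> \<le> K" using bound by simp
  moreover have "x + real N * of_int k < t" if "t \<in> B" for t
  proof -
    have "Min B \<le> t" using that assms by simp
    then show ?thesis using k assms(1) by linarith
  qed
  ultimately show ?thesis using k True assms(1) by (intro exI[of _ k]) auto
next
  case False
  obtain k :: int where k: "Max A < x + real N * of_int k" "x + real N * of_int k \<le> Max A + real N"
    using ex_shift_above[OF assms(1)] by blast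
  have M: "Max A \<in> A" using False assms by simp
  then have "\<bar>Max A\<bar> \<le> K" using bound by simp
  moreover have "x + real N * of_int k < t" if "t \<in> B" for t
    using gap[OF M that] k by linarith
  moreover have "s < x + real N * of_int k" if "s \<in> A" for s
    using Max_ge[OF assms(2) that] k by linarith
  ultimately show ?thesis using k by (intro exI[of _ k]) auto
qed

text \<open>If \<open>x\<close> is close to a point \<open>- lin F c a / e\<close>, its answer \<open>y\<close> lies at the same distance from
  \<open>- lin F c b / e\<close>; this is the step that multiplies the modulus by \<open>fact H\<close>.\<close>

lemma forth_near:
  assumes F: "finite F" "v \<notin> F" and "M \<le> K"
    and ab: "eqv F (2 * H * H) (H * (M + K)) a b" "congr F (N * fact H) a b"
    and R: "\<And>u. u \<in> F \<Longrightarrow> \<bar>b u\<bar> \<le> real R"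
    and c: "small H c" and e: "1 \<le> e" "e \<le> H" and near: "\<bar>lin F c a + real e * x\<bar> \<le> real K"
  shows "\<exists>y. \<bar>y\<bar> \<le> real (K + card F * H * R) \<and> eqv (insert v F) H M (a(v := x)) (b(v := y))
           \<and> congr (insert v F) N (a(v := x)) (b(v := y))"
proof -
  define r where "r = lin F c a + real e * x"
  \<comment> \<open>Solves \<open>lin F c b + e * y = r\<close>, so the form that is close to zero
    takes the same value at both points.\<close>
  define y where "y = (r - lin F c b) / real e"
  have H: "H \<ge> 1" and e0: "real e > 0" using e by auto
  have ey: "real e * y = r - lin F c b" using e0 by (simp add: y_def)
  have HH: "H \<le> 2 * H * H" using H by simp
  have MM: "M \<le> H * (M + K)"
    using H by (metis le_add1 mult_le_mono nat_mult_1)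
  have ab': "eqv F H M a b" using eqv_mono[OF ab(1) HH MM] .
  have abN: "congr F N a b" using congr_dvd[OF ab(2)] by simp
  obtain k :: int where k: "lin F c a - lin F c b = real (N * fact H) * of_int k"
    using congr_lin[OF ab(2)] by blast
  obtain j where j: "fact H = e * j" using dvd_fact[OF e] by (auto elim: dvdE)
  have "real e * (y - x) = lin F c a - lin F c b" using ey by (simp add: r_def algebra_simps)
  also have "\<dots> = real e * (real N * of_int (int j * k))" unfolding k j by simp
  finally have "y - x = real N * of_int (int j * k)" using e0 by simp
  then have cong: "congr (insert v F) N (a(v := x)) (b(v := y))"
    using congr_insert[OF abN F(2)] by blast
  have "\<bar>lin F c b\<bar> \<le> real (card F) * real H * real R"
    by (rule abs_lin_le[OF F(1) c]) (rule R)
  then have "\<bar>real e * y\<bar> \<le> real K + real (card F) * real H * real R"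
    using near unfolding ey r_def by linarith
  moreover have "\<bar>y\<bar> \<le> \<bar>real e * y\<bar>"
    using e by (simp add: abs_mult mult_le_cancel_right1)
  ultimately have y: "\<bar>y\<bar> \<le> real (K + card F * H * R)" by simp
  have "eqv (insert v F) H M (a(v := x)) (b(v := y))"
  proof (rule eqv_insertI[OF F ab'])
    fix c' :: "'a \<Rightarrow> int" and e' :: nat assume c': "small H c'" and e': "1 \<le> e'" "e' \<le> H"
    \<comment> \<open>The new variable is eliminated between the two forms: \<open>e\<close> times
      the form for \<open>c'\<close> and \<open>e'\<close> equals \<open>s + e' * r\<close>. Since
      \<open>e' * r\<close> is at most \<open>H * K\<close> in size, a value of \<open>s\<close>
      beyond \<open>H * (M + K)\<close> cannot be brought back to size \<open>e * M\<close>.\<close>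
    let ?d = "\<lambda>v. int e * c' v - int e' * c v"
    have d: "small (2 * H * H) ?d" using small_comb[OF c' c] e e' by simp
    define s t where "s = lin F ?d a" and "t = lin F ?d b"
    have st: "same (H * (M + K)) s t" using ab(1) d unfolding eqv_def s_def t_def by blast
    have s: "real e * (lin F c' a + real e' * x) = s + real e' * r"
      unfolding s_def r_def lin_comb by (simp add: algebra_simps)
    have "real e * (lin F c' b + real e' * y) = real e * lin F c' b + real e' * (real e * y)"
      by (simp add: algebra_simps)
    then have t: "real e * (lin F c' b + real e' * y) = t + real e' * r"
      unfolding ey t_def lin_comb by (simp add: algebra_simps)
    have r: "\<bar>real e' * r\<bar> \<le> real H * real K"
      using near e' unfolding abs_mult r_def by (intro mult_mono) auto
    have eM: "real e * real M \<le> real H * real M" using e by (intro mult_right_mono) auto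
    have big: "real M < z" if "real e * z = w + real e' * r" "real (H * (M + K)) < w" for w z
    proof -
      have "real e * real M < real e * z" using that eM r by (simp add: algebra_simps)
      then show ?thesis using e0 by simp
    qed
    have small: "z < - real M" if "real e * z = w + real e' * r" "w < - real (H * (M + K))" for w z
    proof -
      have "real e * z < real e * (- real M)" using that eM r by (simp add: algebra_simps)
      then show ?thesis using e0 by (simp only: mult_less_cancel_left_pos)
    qed
    show "same M (lin F c' a + real e' * x) (lin F c' b + real e' * y)"
      using st unfolding same_def
    proof (elim disjE conjE)
      assume "s = t"
      then have "lin F c' a + real e' * x = lin F c' b + real e' * y"
        using s t e0 by (metis less_irrefl mult_left_cancel)
      then show "lin F c' a + real e' * x = lin F c' b + real e' * y \<or>
        real M < lin F c' a + real e' * x \<and> real M < lin F c' b + real e' * y \<or>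
        lin F c' a + real e' * x < - real M \<and> lin F c' b + real e' * y < - real M" by simp
    qed (use big[OF s] big[OF t] small[OF s] small[OF t] in auto)
  qed
  with y cong show ?thesis by blast
qed

text \<open>As no form with the new variable is within \<open>K\<close> of zero, each only asks
  \<open>y\<close> to lie above a point of \<open>A\<close> or below a point of \<open>B\<close>.
  Eliminating the new variable between a form of each kind puts every point of \<open>A\<close> more
  than \<open>N\<close> below every point of \<open>B\<close>. The summand \<open>H * N\<close> of
  \<open>K\<close> pays for this gap, which has room for a \<open>y\<close> congruent to
  \<open>x\<close>.\<close>

lemma forth_far:
  assumes F: "finite F" "v \<notin> F" and H: "1 \<le> H" and N: "1 \<le> N"
    and K: "K = M + H * N"
    and ab: "eqv F (2 * H * H) (2 * H * K) a b" "congr F N a b"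
    and R: "\<And>u. u \<in> F \<Longrightarrow> \<bar>b u\<bar> \<le> real R"
    and far: "\<And>c e. small H c \<Longrightarrow> 1 \<le> e \<Longrightarrow> e \<le> H \<Longrightarrow> real K < \<bar>lin F c a + real e * x\<bar>"
  shows "\<exists>y. \<bar>y\<bar> \<le> real (card F * H * R + M + 2 * N) \<and> eqv (insert v F) H M (a(v := x)) (b(v := y))
           \<and> congr (insert v F) N (a(v := x)) (b(v := y))"
proof -
  define lo where "lo = {(c, e). small H c \<and> 1 \<le> e \<and> e \<le> H \<and> real K < lin F c a + real e * x}"
  define up where "up = {(c, e). small H c \<and> 1 \<le> e \<and> e \<le> H \<and> lin F c a + real e * x < - real K}"
  define A where "A = (\<lambda>(c, e). (- lin F c b + real M) / real e) ` lo"
  define B where "B = (\<lambda>(c, e). (- lin F c b - real M) / real e) ` up"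
  let ?V = "(\<lambda>c. lin F c b) ` {c. small H c} \<times> {1..H}"
  have V: "finite ?V" using finite_lin_values[OF F(1)] by simp
  have "A \<subseteq> (\<lambda>(l, e). (- l + real M) / real e) ` ?V"
    unfolding A_def lo_def by (force simp: image_iff)
  then have fA: "finite A" using V finite_subset by blast
  have "B \<subseteq> (\<lambda>(l, e). (- l - real M) / real e) ` ?V"
    unfolding B_def up_def by (force simp: image_iff)
  then have fB: "finite B" using V finite_subset by blast
  \<comment> \<open>The new variable by itself is one of the forms, so there is at least one bound
    next to which \<open>y\<close> can be placed.\<close>
  have "(\<lambda>v. 0, 1) \<in> lo \<union> up"
    using far[of "\<lambda>v. 0" 1] H by (auto simp: lo_def up_def)
  then have ne: "A \<union> B \<noteq> {}" unfolding A_def B_def by blast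
  have gap: "s + real N < t" if "s \<in> A" "t \<in> B" for s t
  proof -
    obtain c e where c: "small H c" "1 \<le> e" "e \<le> H" "real K < lin F c a + real e * x"
      and s: "s = (- lin F c b + real M) / real e" using \<open>s \<in> A\<close> by (auto simp: A_def lo_def)
    obtain d f where d: "small H d" "1 \<le> f" "f \<le> H" "lin F d a + real f * x < - real K"
      and t: "t = (- lin F d b - real M) / real f" using \<open>t \<in> B\<close> by (auto simp: B_def up_def)
    have e0: "real e > 0" "real f > 0" using c d by auto
    let ?g = "\<lambda>v. int f * c v - int e * d v"
    have "same (2 * H * K) (lin F ?g a) (lin F ?g b)"
      using ab(1) small_comb[OF c(1) d(1), of "int f" "int e"] c d unfolding eqv_def by simp
    moreover have "lin F ?g a > real e * real K + real f * real K"
    proof -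
      have "real f * real K < real f * (lin F c a + real e * x)"
        "real e * (lin F d a + real f * x) < real e * (- real K)"
        using c d e0 by (simp_all only: mult_less_cancel_left_pos)
      then show ?thesis unfolding lin_comb by (simp add: algebra_simps)
    qed
    moreover have "real e * real K \<le> real H * real K" "real f * real K \<le> real H * real K"
      using c d by (auto intro!: mult_right_mono)
    ultimately have "lin F ?g b > real e * real K + real f * real K"
      unfolding same_def by (auto simp: algebra_simps) (use zero_le_mult_iff in \<open>smt (verit) of_nat_0_le_iff\<close>)
    then have gb: "real f * lin F c b - real e * lin F d b > real e * real K + real f * real K"
      unfolding lin_comb by simp
    have "real e * real N \<le> real H * real N" using c by (intro mult_right_mono) auto
    then have "real f * (real M + real e * real N) \<le> real f * real K"
      unfolding K by (intro mult_left_mono) auto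
    moreover have "real e * real M \<le> real e * real K" unfolding K by (intro mult_left_mono) auto
    ultimately have "real f * (- lin F c b + real M) + real e * real f * real N < real e * (- lin F d b - real M)"
      using gb by (simp add: algebra_simps)
    then show ?thesis unfolding s t using e0 by (simp add: field_simps)
  qed
  let ?K = "real (card F * H * R + M)"
  have bd: "\<bar>s\<bar> \<le> ?K" if "s \<in> A \<union> B" for s
  proof -
    obtain p where "p \<in> lo \<union> up" and p: "s = (- lin F (fst p) b + real M) / real (snd p) \<or>
        s = (- lin F (fst p) b - real M) / real (snd p)"
      using \<open>s \<in> A \<union> B\<close> unfolding A_def B_def split_def by blast
    obtain c e where ce: "p = (c, e)" by (cases p)
    have c: "small H c" "1 \<le> e" using \<open>p \<in> lo \<union> up\<close> by (auto simp: ce lo_def up_def)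
    have "\<bar>lin F c b\<bar> \<le> real (card F) * real H * real R"
      by (rule abs_lin_le[OF F(1) c(1)]) (rule R)
    then have "\<bar>real e * s\<bar> \<le> ?K" using p c by (auto simp: ce)
    moreover have "\<bar>s\<bar> \<le> \<bar>real e * s\<bar>" using c by (simp add: abs_mult mult_le_cancel_right1)
    ultimately show ?thesis by linarith
  qed
  obtain k :: int where k: "\<And>s. s \<in> A \<Longrightarrow> s < x + real N * of_int k"
      "\<And>t. t \<in> B \<Longrightarrow> x + real N * of_int k < t" "\<bar>x + real N * of_int k\<bar> \<le> ?K + 2 * real N"
    using ex_shift_between[OF N fA fB ne gap bd, of x] by blast
  define y where "y = x + real N * of_int k"
  have "M \<le> K" using K by simp
  moreover have "1 * K \<le> 2 * H * K" using H by (intro mult_le_mono) auto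
  ultimately have M: "M \<le> 2 * H * K" by linarith
  have "eqv (insert v F) H M (a(v := x)) (b(v := y))"
  proof (rule eqv_insertI[OF F eqv_mono[OF ab(1) _ M]])
    show "H \<le> 2 * H * H" using H by simp
  next
    fix c :: "'a \<Rightarrow> int" and e :: nat assume c: "small H c" and e: "1 \<le> e" "e \<le> H"
    have e0: "real e > 0" using e by simp
    show "same M (lin F c a + real e * x) (lin F c b + real e * y)"
    proof (cases "real K < lin F c a + real e * x")
      case True
      then have "(- lin F c b + real M) / real e < y"
        unfolding y_def using k(1) c e by (auto simp: A_def lo_def)
      then show ?thesis using True \<open>M \<le> K\<close> e0 by (simp add: same_def field_simps)
    next
      case False
      then have neg: "lin F c a + real e * x < - real K" using far[OF c e] by linarith
      then have "y < (- lin F c b - real M) / real e"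
        unfolding y_def using k(2) c e by (auto simp: B_def up_def)
      then have "lin F c b + real e * y < - real M" using e0 by (simp add: field_simps)
      then show ?thesis using neg \<open>M \<le> K\<close> by (simp add: same_def)
    qed
  qed
  moreover have "congr (insert v F) N (a(v := x)) (b(v := y))"
    using congr_insert[OF ab(2) F(2), of y x k] by (simp add: y_def)
  ultimately show ?thesis using k(3) by (intro exI[of _ y]) (simp add: y_def)
qed

text \<open>The order of quantifiers matters. \<open>H'\<close>, \<open>M'\<close> and
  \<open>N'\<close> are fixed before \<open>R\<close>, so any single \<open>b\<close> can be
  handled; \<open>R'\<close> depends on \<open>R\<close> but on no point, so representatives and
  witnesses are bounded uniformly.\<close>

lemma forth:
  fixes F :: "'v set" and H M N :: nat
  assumes F: "finite F" "v \<notin> F" and H: "1 \<le> H" and N: "1 \<le> N"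
  obtains H' M' N' where "1 \<le> H'" "1 \<le> N'"
    "\<And>R. \<exists>R'. \<forall>a b x. eqv F H' M' a b \<longrightarrow> congr F N' a b \<longrightarrow> (\<forall>u\<in>F. \<bar>b u\<bar> \<le> real R) \<longrightarrow>
       (\<exists>y. \<bar>y\<bar> \<le> real R' \<and> eqv (insert v F) H M (a(v := x)) (b(v := y))
           \<and> congr (insert v F) N (a(v := x)) (b(v := y)))"
proof -
  define K where "K = M + H * N"
  define M' where "M' = 2 * H * (M + K)"
  have M': "H * (M + K) \<le> M'" "2 * H * K \<le> M'" unfolding M'_def by (auto simp: algebra_simps)
  have *: "\<exists>y. \<bar>y\<bar> \<le> real (K + card F * H * R + M + 2 * N)
      \<and> eqv (insert v F) H M (a(v := x)) (b(v := y)) \<and> congr (insert v F) N (a(v := x)) (b(v := y))"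
    if ab: "eqv F (2 * H * H) M' a b" "congr F (N * fact H) a b" "\<forall>u\<in>F. \<bar>b u\<bar> \<le> real R"
    for R x and a b :: "'v \<Rightarrow> real"
  proof (cases "\<exists>c e. small H c \<and> 1 \<le> e \<and> e \<le> H \<and> \<bar>lin F c a + real e * x\<bar> \<le> real K")
    case True
    then obtain c e where c: "small H c" "1 \<le> e" "e \<le> H" "\<bar>lin F c a + real e * x\<bar> \<le> real K" by blast
    have "M \<le> K" by (simp add: K_def)
    from forth_near[OF F this eqv_mono[OF ab(1) order_refl M'(1)] ab(2) _ c, of R] ab(3)
    obtain y where "\<bar>y\<bar> \<le> real (K + card F * H * R)" "eqv (insert v F) H M (a(v := x)) (b(v := y))"
      "congr (insert v F) N (a(v := x)) (b(v := y))" by blast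
    then show ?thesis by (intro exI[of _ y]) auto
  next
    case False
    then have far: "\<And>c e. small H c \<Longrightarrow> 1 \<le> e \<Longrightarrow> e \<le> H \<Longrightarrow> real K < \<bar>lin F c a + real e * x\<bar>"
      by (meson not_le)
    have "congr F N a b" using congr_dvd[OF ab(2)] by simp
    from forth_far[OF F H N K_def eqv_mono[OF ab(1) order_refl M'(2)] this _ far, of R] ab(3)
    obtain y where "\<bar>y\<bar> \<le> real (card F * H * R + M + 2 * N)" "eqv (insert v F) H M (a(v := x)) (b(v := y))"
      "congr (insert v F) N (a(v := x)) (b(v := y))" by blast
    then show ?thesis by (intro exI[of _ y]) auto
  qed
  show thesis
    by (rule that[of "2 * H * H" "N * fact H" M']) (use H N * in \<open>auto simp: Suc_le_eq, blast?\<close>)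
qed

subsection \<open>Invariance of formulas\<close>

lemma lin_restrict:
  assumes "finite G" "F \<subseteq> G"
  shows "lin G (\<lambda>v. if v \<in> F then c v else 0) e = lin F c e"
  unfolding lin_def using assms by (intro sum.mono_neutral_cong_right) auto

lemma small_restrict: "small H c \<Longrightarrow> small H (\<lambda>v. if v \<in> F then c v else 0)"
  by (simp add: small_def)

lemma lin_single:
  assumes "finite F" "u \<in> F"
  shows "lin F (\<lambda>v. if v = u then k else 0) e = of_int k * e u"
proof -
  have "lin F (\<lambda>v. if v = u then k else 0) e = (\<Sum>v\<in>F. if v = u then of_int k * e u else 0)"
    unfolding lin_def by (intro sum.cong) auto
  then show ?thesis using assms by simp
qed

lemma eqv_subset:
  assumes "eqv G H M a b" "finite G" "F \<subseteq> G" shows "eqv F H M a b"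
  unfolding eqv_def
proof (intro allI impI)
  fix c :: "'a \<Rightarrow> int" assume "small H c"
  then show "same M (lin F c a) (lin F c b)"
    using assms(1) small_restrict[of H c F] unfolding eqv_def by (metis lin_restrict[OF assms(2,3)])
qed

lemma congr_subset: "congr G N a b \<Longrightarrow> F \<subseteq> G \<Longrightarrow> congr F N a b"
  by (auto simp: congr_def)

lemma congr_sym:
  assumes "congr F N a b" shows "congr F N b a"
  unfolding congr_def
proof
  fix v assume "v \<in> F"
  then obtain k :: int where "a v - b v = real N * of_int k" using assms by (auto simp: congr_def)
  then have "b v - a v = real N * of_int (- k)" by simp
  then show "\<exists>k::int. b v - a v = real N * of_int k" by blast
qed

lemma ex_bound:
  assumes "finite F" shows "\<exists>R. \<forall>u\<in>F. \<bar>b u\<bar> \<le> real R"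
  using assms
proof (induction F)
  case (insert v F)
  then obtain R where R: "\<forall>u\<in>F. \<bar>b u\<bar> \<le> real R" by blast
  obtain S where "\<bar>b v\<bar> \<le> real S" using real_arch_simple by blast
  then show ?case using R by (intro exI[of _ "max R S"]) fastforce
qed simp

text \<open>The moves of \<open>forth\<close> are the coordinates of \<open>a\<close> itself, one
  variable after the other, and the answers form \<open>b\<close>. Over the empty set of variables
  any two assignments are equivalent, and every answer is bounded independently of
  \<open>a\<close>.\<close>

lemma bounded_rep:
  assumes "finite F" "1 \<le> H" "1 \<le> N"
  shows "\<exists>R. \<forall>a. \<exists>b. (\<forall>v\<in>F. \<bar>b v\<bar> \<le> real R) \<and> eqv F H M a b \<and> congr F N a b"
  using assms
proof (induction F arbitrary: H M N)
  case empty
  show ?case by (auto simp: eqv_def same_def congr_def lin_def)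
next
  case (insert v F)
  obtain H' M' N' where H': "1 \<le> H'" "1 \<le> N'" and
    forth: "\<And>R. \<exists>R'. \<forall>a b x. eqv F H' M' a b \<longrightarrow> congr F N' a b \<longrightarrow> (\<forall>u\<in>F. \<bar>b u\<bar> \<le> real R) \<longrightarrow>
       (\<exists>y. \<bar>y\<bar> \<le> real R' \<and> eqv (insert v F) H M (a(v := x)) (b(v := y))
           \<and> congr (insert v F) N (a(v := x)) (b(v := y)))"
    using forth[OF insert.hyps(1,2) insert.prems, of M] by metis
  obtain R where R: "\<And>a. \<exists>b. (\<forall>v\<in>F. \<bar>b v\<bar> \<le> real R) \<and> eqv F H' M' a b \<and> congr F N' a b"
    using insert.IH[OF H', of M'] by blast
  obtain R' where R': "\<And>a b x. eqv F H' M' a b \<Longrightarrow> congr F N' a b \<Longrightarrow> (\<forall>u\<in>F. \<bar>b u\<bar> \<le> real R) \<Longrightarrow>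
       (\<exists>y. \<bar>y\<bar> \<le> real R' \<and> eqv (insert v F) H M (a(v := x)) (b(v := y))
           \<and> congr (insert v F) N (a(v := x)) (b(v := y)))"
    using forth[of R] by blast
  show ?case
  proof (intro exI[of _ "max R R'"] allI)
    fix a
    obtain b where b: "\<forall>v\<in>F. \<bar>b v\<bar> \<le> real R" "eqv F H' M' a b" "congr F N' a b"
      using R by blast
    obtain y where y: "\<bar>y\<bar> \<le> real R'" "eqv (insert v F) H M (a(v := a v)) (b(v := y))"
           "congr (insert v F) N (a(v := a v)) (b(v := y))"
      using R'[OF b(2,3,1)] by blast
    have "\<forall>u\<in>insert v F. \<bar>(b(v := y)) u\<bar> \<le> real (max R R')"
      using y(1) b(1) by fastforce
    then show "\<exists>b. (\<forall>v\<in>insert v F. \<bar>b v\<bar> \<le> real (max R R')) \<and> eqv (insert v F) H M a b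
      \<and> congr (insert v F) N a b" using y(2,3) unfolding fun_upd_triv by blast
  qed
qed

section \<open>Signs of affine forms with integer coefficients\<close>

definition sgneq :: "'v set \<Rightarrow> nat \<Rightarrow> ('v \<Rightarrow> real) \<Rightarrow> ('v \<Rightarrow> real) \<Rightarrow> bool" where
  "sgneq F H a b \<longleftrightarrow> (\<forall>c d. small H c \<longrightarrow> \<bar>d\<bar> \<le> int H \<longrightarrow>
     sgn (lin F c a + of_int d) = sgn (lin F c b + of_int d))"

lemma sgneqD: "sgneq F H a b \<Longrightarrow> small H c \<Longrightarrow> \<bar>d\<bar> \<le> int H \<Longrightarrow>
    sgn (lin F c a + of_int d) = sgn (lin F c b + of_int d)"
  by (simp add: sgneq_def)

lemma sgneq_mono: "sgneq F H' a b \<Longrightarrow> H \<le> H' \<Longrightarrow> sgneq F H a b"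
  unfolding sgneq_def by (meson small_mono order_trans of_nat_mono)

lemma sgneq_sym: "sgneq F H a b \<Longrightarrow> sgneq F H b a"
  by (simp add: sgneq_def)

lemma sgneq_subset:
  assumes "sgneq G H a b" "finite G" "F \<subseteq> G" shows "sgneq F H a b"
  unfolding sgneq_def
proof (intro allI impI)
  fix c :: "'a \<Rightarrow> int" and d :: int assume "small H c" "\<bar>d\<bar> \<le> int H"
  then show "sgn (lin F c a + of_int d) = sgn (lin F c b + of_int d)"
    using sgneqD[OF assms(1) small_restrict[of H c F]] by (simp add: lin_restrict[OF assms(2,3)])
qed

lemma sgn_eq_iff:
  fixes s t :: real
  assumes "sgn s = sgn t"
  shows "s = 0 \<longleftrightarrow> t = 0" "s < 0 \<longleftrightarrow> t < 0" "0 < s \<longleftrightarrow> 0 < t" "s \<le> 0 \<longleftrightarrow> t \<le> 0"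
  using assms by (auto simp: sgn_real_def split: if_splits)

text \<open>The strip \<open>\<bar>a v\<bar> \<le> R\<close> is cut out by the signs of
  \<open>a v - R\<close> and \<open>- a v - R\<close>.\<close>

lemma sgneq_abs_le:
  assumes "finite F" "v \<in> F" "sgneq F H a b" "R \<le> H" "1 \<le> H" "\<bar>a v\<bar> \<le> real R"
  shows "\<bar>b v\<bar> \<le> real R"
proof -
  have *: "sgn (of_int i * a v - real R) = sgn (of_int i * b v - real R)" if "\<bar>i\<bar> = 1" for i
    using sgneqD[OF assms(3), of "\<lambda>u. if u = v then i else 0" "- int R"] assms that
    by (simp add: small_def lin_single)
  from *[of 1] *[of "-1"] assms(6) show ?thesis
    by (simp add: abs_le_iff) (smt (verit) sgn_real_def)
qed

lemma ex_rat_between: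
  fixes A B :: "real set"
  assumes "finite A" "finite B" "\<And>s t. s \<in> A \<Longrightarrow> t \<in> B \<Longrightarrow> s < t"
  shows "\<exists>y\<in>\<rat>. (\<forall>s\<in>A. s < y) \<and> (\<forall>t\<in>B. y < t)"
proof -
  define l where "l = (if A = {} then if B = {} then 0 else Min B - 1 else Max A)"
  define u where "u = (if B = {} then l + 1 else Min B)"
  have "l < u" unfolding l_def u_def using assms(3)[OF Max_in Min_in] assms(1,2)
    by (simp del: Min_gr_iff Max_less_iff)
  then obtain y where y: "y \<in> \<rat>" "l < y" "y < u" using Rats_dense_in_real by blast
  have "s \<le> l" if "s \<in> A" for s using that assms by (auto simp: l_def)
  moreover have "u \<le> t" if "t \<in> B" for t using that assms by (auto simp: u_def)
  ultimately show ?thesis using y by (meson order.strict_trans1 order.strict_trans2)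
qed

lemma sgneq_insertI:
  assumes "finite F" "v \<notin> F" "sgneq F H a b"
    and pos: "\<And>c d e. small H c \<Longrightarrow> \<bar>d\<bar> \<le> int H \<Longrightarrow> 1 \<le> e \<Longrightarrow> e \<le> H \<Longrightarrow>
        sgn (lin F c a + of_int d + real e * x) = sgn (lin F c b + of_int d + real e * y)"
  shows "sgneq (insert v F) H (a(v := x)) (b(v := y))"
  unfolding sgneq_def
proof (intro allI impI)
  fix c :: "'a \<Rightarrow> int" and d :: int assume c: "small H c" and d: "\<bar>d\<bar> \<le> int H"
  then have cv: "\<bar>c v\<bar> \<le> int H" by (simp add: small_def)
  consider "c v = 0" | "c v > 0" | "c v < 0" by linarith
  then have "sgn (lin F c a + of_int d + of_int (c v) * x) = sgn (lin F c b + of_int d + of_int (c v) * y)"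
  proof cases
    case 1 then show ?thesis using sgneqD[OF assms(3) c d] by simp
  next
    case 2 then show ?thesis using pos[OF c d, of "nat (c v)"] cv by simp
  next
    case 3
    have "sgn (- (lin F c a + of_int d + of_int (c v) * x)) = sgn (- (lin F c b + of_int d + of_int (c v) * y))"
      using pos[OF small_uminus[OF c], of "- d" "nat (- c v)"] cv 3 d by (simp add: lin_uminus)
    then show ?thesis unfolding sgn_minus by simp
  qed
  then show "sgn (lin (insert v F) c (a(v := x)) + of_int d) = sgn (lin (insert v F) c (b(v := y)) + of_int d)"
    using assms(1,2) by (simp add: lin_insert algebra_simps)
qed

text \<open>Fourier-Motzkin elimination. Either \<open>x\<close> is a zero of some form, and
  \<open>y\<close> solves the same equation over \<open>b\<close>, which gives a rational number if
  \<open>b\<close> is rational; or \<open>x\<close> lies strictly between zeros of forms, and the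
  corresponding open interval over \<open>b\<close> contains a rational number.\<close>

lemma sgneq_forth:
  assumes F: "finite F" "v \<notin> F" and ab: "sgneq F (2 * H * H) a b"
  shows "\<exists>y. sgneq (insert v F) H (a(v := x)) (b(v := y)) \<and> ((\<forall>u\<in>F. b u \<in> \<rat>) \<longrightarrow> y \<in> \<rat>)"
proof -
  have "H \<le> 2 * H * H" by (cases H) auto
  then have ab': "sgneq F H a b" using ab sgneq_mono by blast
  have comb: "sgn (real f * (lin F c a + of_int d) - real e * (lin F c' a + of_int d'))
      = sgn (real f * (lin F c b + of_int d) - real e * (lin F c' b + of_int d'))"
    if "small H c" "small H c'" "\<bar>d\<bar> \<le> int H" "\<bar>d'\<bar> \<le> int H" "e \<le> H" "f \<le> H" for c c' d d' e f
  proof -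
    have "small (2 * H * H) (\<lambda>v. int f * c v - int e * c' v)"
      using small_comb that by (metis abs_of_nat of_nat_mono)
    moreover have "\<bar>int f * d - int e * d'\<bar> \<le> int (2 * H * H)"
      using small_comb[of H "\<lambda>_. d" "\<lambda>_. d'" "int f" "int e"] that by (simp add: small_def)
    ultimately have "sgn (lin F (\<lambda>v. int f * c v - int e * c' v) a + of_int (int f * d - int e * d'))
       = sgn (lin F (\<lambda>v. int f * c v - int e * c' v) b + of_int (int f * d - int e * d'))"
      using sgneqD[OF ab] by blast
    then show ?thesis unfolding lin_comb by (simp add: algebra_simps)
  qed
  show ?thesis
  proof (cases "\<exists>c d e. small H c \<and> \<bar>d\<bar> \<le> int H \<and> 1 \<le> e \<and> e \<le> H \<and> lin F c a + of_int d + real e * x = 0")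
    case True
    then obtain c d e where c: "small H c" "\<bar>d\<bar> \<le> int H" "1 \<le> e" "e \<le> H"
      and x: "lin F c a + of_int d + real e * x = 0" by blast
    define y where "y = - (lin F c b + of_int d) / real e"
    have e0: "real e > 0" using c by simp
    have ex: "real e * x = - (lin F c a + of_int d)" using x by linarith
    have ey: "real e * y = - (lin F c b + of_int d)" using e0 by (simp add: y_def)
    have "sgneq (insert v F) H (a(v := x)) (b(v := y))"
    proof (rule sgneq_insertI[OF F ab'])
      fix c' :: "'a \<Rightarrow> int" and d' :: int and e' :: nat
      assume c': "small H c'" "\<bar>d'\<bar> \<le> int H" "1 \<le> e'" "e' \<le> H"
      have *: "sgn (lin F c' r + of_int d' + real e' * z)
          = sgn (real e * (lin F c' r + of_int d') - real e' * (lin F c r + of_int d))"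
        if "real e * z = - (lin F c r + of_int d)" for r z
      proof -
        have "sgn (lin F c' r + of_int d' + real e' * z) = sgn (real e * (lin F c' r + of_int d' + real e' * z))"
          using e0 by (simp add: sgn_mult)
        also have "real e * (lin F c' r + of_int d' + real e' * z)
            = real e * (lin F c' r + of_int d') + real e' * (real e * z)"
          by (simp add: algebra_simps)
        finally show ?thesis unfolding that by (simp add: algebra_simps)
      qed
      show "sgn (lin F c' a + of_int d' + real e' * x) = sgn (lin F c' b + of_int d' + real e' * y)"
        unfolding *[OF ex] *[OF ey] using comb c c' by blast
    qed
    moreover have "y \<in> \<rat>" if "\<forall>u\<in>F. b u \<in> \<rat>"
      unfolding y_def lin_def using that
      by (intro Rats_divide Rats_minus_iff[THEN iffD2] Rats_add Rats_sum Rats_mult) auto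
    ultimately show ?thesis by blast
  next
    case False
    define lo where "lo = {(c, d, e). small H c \<and> \<bar>d\<bar> \<le> int H \<and> 1 \<le> e \<and> e \<le> H \<and> 0 < lin F c a + of_int d + real e * x}"
    define up where "up = {(c, d, e). small H c \<and> \<bar>d\<bar> \<le> int H \<and> 1 \<le> e \<and> e \<le> H \<and> lin F c a + of_int d + real e * x < 0}"
    define p where "p = (\<lambda>(c, d, e). - (lin F c b + of_int d) / real e)"
    let ?V = "(\<lambda>c. lin F c b) ` {c. small H c} \<times> {- int H..int H} \<times> {1..H}"
    have V: "finite ?V" using finite_lin_values[OF F(1)] by simp
    have "p ` (lo \<union> up) \<subseteq> (\<lambda>(l, d, e). - (l + of_int d) / real e) ` ?V"
      unfolding p_def lo_def up_def by (fastforce simp: image_iff abs_le_iff)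
    then have "finite (p ` (lo \<union> up))" using V finite_subset by blast
    then have fin: "finite (p ` lo)" "finite (p ` up)" by (simp_all add: image_Un)
    have lt: "s < t" if "s \<in> p ` lo" "t \<in> p ` up" for s t
    proof -
      obtain c d e where c: "small H c" "\<bar>d\<bar> \<le> int H" "1 \<le> e" "e \<le> H" "0 < lin F c a + of_int d + real e * x"
        and s: "s = - (lin F c b + of_int d) / real e" using \<open>s \<in> p ` lo\<close> by (auto simp: p_def lo_def)
      obtain c' d' f where c': "small H c'" "\<bar>d'\<bar> \<le> int H" "1 \<le> f" "f \<le> H" "lin F c' a + of_int d' + real f * x < 0"
        and t: "t = - (lin F c' b + of_int d') / real f" using \<open>t \<in> p ` up\<close> by (auto simp: p_def up_def)
      have e0: "real e > 0" "real f > 0" using c c' by auto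
      have "0 < real f * (lin F c a + of_int d + real e * x)" using c(5) e0 by simp
      moreover have "real e * (lin F c' a + of_int d' + real f * x) < 0"
        using c'(5) e0 by (simp add: mult_pos_neg)
      ultimately have "0 < real f * (lin F c a + of_int d) - real e * (lin F c' a + of_int d')"
        by (simp add: algebra_simps)
      then have "0 < real f * (lin F c b + of_int d) - real e * (lin F c' b + of_int d')"
        using sgn_eq_iff(3)[OF comb[OF c(1) c'(1) c(2) c'(2) c(4) c'(4)]] by simp
      then show ?thesis unfolding s t using e0 by (simp add: field_simps)
    qed
    obtain y where y: "y \<in> \<rat>" "\<forall>s\<in>p ` lo. s < y" "\<forall>t\<in>p ` up. y < t"
      using ex_rat_between[OF fin lt] by blast
    have "sgneq (insert v F) H (a(v := x)) (b(v := y))"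
    proof (rule sgneq_insertI[OF F ab'])
      fix c :: "'a \<Rightarrow> int" and d :: int and e :: nat
      assume c: "small H c" "\<bar>d\<bar> \<le> int H" "1 \<le> e" "e \<le> H"
      have e0: "real e > 0" using c by simp
      consider "0 < lin F c a + of_int d + real e * x" | "lin F c a + of_int d + real e * x < 0"
        using False c by (meson linorder_neqE_linordered_idom)
      then show "sgn (lin F c a + of_int d + real e * x) = sgn (lin F c b + of_int d + real e * y)"
      proof cases
        case 1
        then have "p (c, d, e) < y" using c y(2) by (auto simp: lo_def)
        then have "0 < lin F c b + of_int d + real e * y" using e0 by (simp add: p_def field_simps)
        then show ?thesis using 1 by simp
      next
        case 2
        then have "y < p (c, d, e)" using c y(3) by (auto simp: up_def)
        then have "lin F c b + of_int d + real e * y < 0" using e0 by (simp add: p_def field_simps)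
        then show ?thesis using 2 by simp
      qed
    qed
    then show ?thesis using y(1) by blast
  qed
qed

text \<open>Iterates \<open>sgneq_forth\<close> over \<open>G\<close>. With \<open>F\<close> empty
  it produces rational points sign-equivalent to given real ones; with \<open>F\<close> one half of
  the variables it carries an auxiliary point along from \<open>a\<close> to
  \<open>b\<close>.\<close>

lemma sgneq_extend:
  assumes "finite F" "finite G"
  shows "\<exists>H'\<ge>H. \<forall>a b. sgneq F H' a b \<longrightarrow> (\<exists>b'. (\<forall>u\<in>F. b' u = b u) \<and> sgneq (F \<union> G) H a b' \<and>
     ((\<forall>u\<in>F. b u \<in> \<rat>) \<longrightarrow> (\<forall>u\<in>F \<union> G. b' u \<in> \<rat>)))"
  using assms(2)
proof (induction G arbitrary: H)
  case empty
  show ?case by (intro exI[of _ H]) auto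
next
  case (insert v G)
  show ?case
  proof (cases "v \<in> F")
    case True
    then have "F \<union> insert v G = F \<union> G" by blast
    then show ?thesis using insert.IH[of H] by simp
  next
    case False
    have "H \<le> 2 * H * H" by (cases H) auto
    from insert.IH[of "2 * H * H"] obtain H' where H': "2 * H * H \<le> H'"
      and ext: "\<And>a b. sgneq F H' a b \<Longrightarrow> \<exists>b'. (\<forall>u\<in>F. b' u = b u) \<and> sgneq (F \<union> G) (2 * H * H) a b' \<and>
        ((\<forall>u\<in>F. b u \<in> \<rat>) \<longrightarrow> (\<forall>u\<in>F \<union> G. b' u \<in> \<rat>))" by blast
    have fin: "finite (F \<union> G)" "v \<notin> F \<union> G" using assms(1) insert False by auto
    show ?thesis
    proof (intro exI[of _ H'] conjI allI impI)
      show "H \<le> H'" using H' \<open>H \<le> 2 * H * H\<close> by linarith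
      fix a b assume "sgneq F H' a b"
      from ext[OF this] obtain b' where b': "\<forall>u\<in>F. b' u = b u" "sgneq (F \<union> G) (2 * H * H) a b'"
        "(\<forall>u\<in>F. b u \<in> \<rat>) \<longrightarrow> (\<forall>u\<in>F \<union> G. b' u \<in> \<rat>)" by blast
      obtain y where y: "sgneq (insert v (F \<union> G)) H (a(v := a v)) (b'(v := y))"
        "(\<forall>u\<in>F \<union> G. b' u \<in> \<rat>) \<longrightarrow> y \<in> \<rat>"
        using sgneq_forth[OF fin b'(2), of "a v"] by blast
      show "\<exists>b'. (\<forall>u\<in>F. b' u = b u) \<and> sgneq (F \<union> insert v G) H a b' \<and>
        ((\<forall>u\<in>F. b u \<in> \<rat>) \<longrightarrow> (\<forall>u\<in>F \<union> insert v G. b' u \<in> \<rat>))"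
        using b' y False by (intro exI[of _ "b'(v := y)"]) auto
    qed
  qed
qed

section \<open>Terms as affine forms, and formulas under the equivalences\<close>

primrec coef :: "'v rtm \<Rightarrow> 'v \<Rightarrow> int" where
  "coef (Var u) = (\<lambda>v. if v = u then 1 else 0)"
| "coef One = (\<lambda>v. 0)"
| "coef (Add s t) = (\<lambda>v. coef s v + coef t v)"

primrec const :: "'v rtm \<Rightarrow> int" where
  "const (Var u) = 0"
| "const One = 1"
| "const (Add s t) = const s + const t"

lemma tm_val_lin:
  "finite F \<Longrightarrow> tm_vars t \<subseteq> F \<Longrightarrow> tm_val e t = lin F (coef t) e + of_int (const t)"
proof (induction t)
  case (Var u)
  then show ?case by (simp add: lin_single)
next
  case One
  then show ?case by simp
next
  case (Add s t)
  have "lin F (coef (Add s t)) e = lin F (coef s) e + lin F (coef t) e"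
    by (simp add: lin_def sum.distrib algebra_simps)
  then show ?case using Add by simp
qed

lemma const_eq_0: "One_sym \<notin> tm_symbols t \<Longrightarrow> const t = 0"
  by (induction t) auto

lemma ex_small_coef: "\<exists>H. small H (coef t)"
proof (induction t)
  case (Var u)
  then show ?case by (intro exI[of _ 1]) (simp add: small_def)
next
  case One
  then show ?case by (simp add: small_def)
next
  case (Add s t)
  then obtain H K where H: "small H (coef s)" "small K (coef t)" by blast
  have "small (H + K) (coef (Add s t))"
    unfolding small_def
  proof
    fix v
    have "\<bar>coef s v\<bar> \<le> int H" "\<bar>coef t v\<bar> \<le> int K" using H by (auto simp: small_def)
    then show "\<bar>coef (Add s t) v\<bar> \<le> int (H + K)" by simp
  qed
  then show ?case by blast
qed

lemma finite_tm_vars: "finite (tm_vars t)"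
  by (induction t) auto

lemma finite_free_vars: "finite (free_vars p)"
  by (induction p) (auto simp: finite_tm_vars)

text \<open>Turns both kinds of comparison into a sign condition on a single form. Without the
  symbol \<open>1\<close> the form is homogeneous, as \<open>eqv\<close> requires.\<close>

lemma tm_val_diff:
  "\<exists>H c d. 1 \<le> H \<and> small H c \<and> \<bar>d\<bar> \<le> int H \<and>
    (One_sym \<notin> tm_symbols s \<union> tm_symbols t \<longrightarrow> d = 0) \<and>
    (\<forall>e. tm_val e s - tm_val e t = lin (tm_vars s \<union> tm_vars t) c e + of_int d)"
proof -
  obtain H K where H: "small H (coef s)" "small K (coef t)" using ex_small_coef by blast
  define d where "d = const s - const t"
  define c where "c = (\<lambda>v. coef s v - coef t v)"
  have "small (H + K + nat \<bar>d\<bar> + 1) c"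
    unfolding small_def
  proof
    fix v
    have "\<bar>coef s v\<bar> \<le> int H" "\<bar>coef t v\<bar> \<le> int K" using H by (auto simp: small_def)
    then show "\<bar>c v\<bar> \<le> int (H + K + nat \<bar>d\<bar> + 1)" by (simp add: c_def)
  qed
  moreover have "tm_val e s - tm_val e t = lin (tm_vars s \<union> tm_vars t) c e + of_int d" for e
    using lin_comb[of "tm_vars s \<union> tm_vars t" 1 "coef s" 1 "coef t" e]
    by (simp add: c_def d_def finite_tm_vars tm_val_lin[of "tm_vars s \<union> tm_vars t"])
  ultimately show ?thesis
    by (intro exI[of _ "H + K + nat \<bar>d\<bar> + 1"] exI[of _ c] exI[of _ d])
      (auto simp: d_def const_eq_0)
qed

text \<open>Comparisons depend on signs, which \<open>eqv\<close> preserves even for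
  \<open>M = 0\<close>, and integrality depends on residues modulo 1. A quantifier costs one
  application of \<open>forth\<close>; the converse implication follows by symmetry of the two
  relations.\<close>

lemma RZ_formula_invariant:
  "One_sym \<notin> symbols p \<Longrightarrow> \<exists>H M N. 1 \<le> H \<and> 1 \<le> N \<and>
    (\<forall>a b. eqv (free_vars p) H M a b \<longrightarrow> congr (free_vars p) N a b \<longrightarrow> sat a p = sat b p)"
proof (induction p)
  case (Eq s t)
  let ?F = "tm_vars s \<union> tm_vars t"
  obtain H c d where H: "1 \<le> H" "small H c" "One_sym \<notin> tm_symbols s \<union> tm_symbols t \<Longrightarrow> d = 0"
    and st: "\<And>e. tm_val e s - tm_val e t = lin ?F c e + of_int d"
    using tm_val_diff[of s t] by auto
  have "sat a (Eq s t) = sat b (Eq s t)" if "eqv ?F H 0 a b" for a b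
    using same_sgn that H sgn_eq_iff(1) st[of a] st[of b] Eq.prems unfolding eqv_def
    by (metis add.right_neutral eq_iff_diff_eq_0 of_int_0 sat.simps(1) symbols.simps(1))
  then show ?case using H(1) by (intro exI[of _ H] exI[of _ 0] exI[of _ 1]) auto
next
  case (Lt s t)
  let ?F = "tm_vars s \<union> tm_vars t"
  obtain H c d where H: "1 \<le> H" "small H c" "One_sym \<notin> tm_symbols s \<union> tm_symbols t \<Longrightarrow> d = 0"
    and st: "\<And>e. tm_val e s - tm_val e t = lin ?F c e + of_int d"
    using tm_val_diff[of s t] by auto
  have d: "d = 0" using H(3) Lt.prems by simp
  have "sat a (Lt s t) = sat b (Lt s t)" if "eqv ?F H 0 a b" for a b
  proof -
    have "sgn (tm_val a s - tm_val a t) = sgn (tm_val b s - tm_val b t)"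
      using that H(2) unfolding st d eqv_def by (auto intro: same_sgn)
    then show ?thesis using sgn_eq_iff(2) by fastforce
  qed
  then show ?case using H(1) by (intro exI[of _ H] exI[of _ 0] exI[of _ 1]) auto
next
  case (Integer t)
  have "sat a (Integer t) = sat b (Integer t)" if "congr (tm_vars t) 1 a b" for a b
  proof -
    obtain k :: int where "lin (tm_vars t) (coef t) a - lin (tm_vars t) (coef t) b = of_int k"
      using congr_lin[OF \<open>congr (tm_vars t) 1 a b\<close>] by auto
    then have "tm_val a t = tm_val b t + of_int k" using tm_val_lin[OF finite_tm_vars subset_refl, of _ t] by simp
    then show ?thesis by simp
  qed
  then show ?case by (intro exI[of _ 1] exI[of _ 0]) auto
next
  case (Neg p)
  then show ?case by simp
next
  case (Conj p q)
  obtain H M N where p: "1 \<le> H" "1 \<le> N" "\<And>a b. eqv (free_vars p) H M a b \<Longrightarrow> congr (free_vars p) N a b \<Longrightarrow> sat a p = sat b p"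
    using Conj by auto
  obtain H' M' N' where q: "1 \<le> H'" "1 \<le> N'" "\<And>a b. eqv (free_vars q) H' M' a b \<Longrightarrow> congr (free_vars q) N' a b \<Longrightarrow> sat a q = sat b q"
    using Conj by auto
  have "sat a (Conj p q) = sat b (Conj p q)"
    if "eqv (free_vars (Conj p q)) (max H H') (max M M') a b" "congr (free_vars (Conj p q)) (N * N') a b" for a b
  proof -
    have e: "eqv (free_vars p) (max H H') (max M M') a b" "eqv (free_vars q) (max H H') (max M M') a b"
      using eqv_subset[OF that(1) finite_free_vars] by auto
    have c: "congr (free_vars p) (N * N') a b" "congr (free_vars q) (N * N') a b"
      using congr_subset[OF that(2)] by auto
    show ?thesis using p(3) q(3) e c eqv_mono congr_dvd
      by (metis dvd_triv_left dvd_triv_right max.cobounded1 max.cobounded2 sat.simps(5))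
  qed
  then show ?case using p q
    by (intro exI[of _ "max H H'"] exI[of _ "max M M'"] exI[of _ "N * N'"]) auto
next
  case (Ex v p)
  let ?F = "free_vars (Ex v p)"
  obtain H M N where p: "1 \<le> H" "1 \<le> N" "\<And>a b. eqv (free_vars p) H M a b \<Longrightarrow> congr (free_vars p) N a b \<Longrightarrow> sat a p = sat b p"
    using Ex by auto
  have v: "v \<notin> ?F" by simp
  obtain H' M' N' where H': "1 \<le> H'" "1 \<le> N'" and
    forth: "\<And>R. \<exists>R'. \<forall>a b x. eqv ?F H' M' a b \<longrightarrow> congr ?F N' a b \<longrightarrow> (\<forall>u\<in>?F. \<bar>b u\<bar> \<le> real R) \<longrightarrow>
       (\<exists>y. \<bar>y\<bar> \<le> real R' \<and> eqv (insert v ?F) H M (a(v := x)) (b(v := y))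
           \<and> congr (insert v ?F) N (a(v := x)) (b(v := y)))"
    using forth[OF finite_free_vars[of "Ex v p"] _ p(1,2), of v M] v by metis
  have imp: "sat b (Ex v p)" if "eqv ?F H' M' a b" "congr ?F N' a b" "sat a (Ex v p)" for a b
  proof -
    obtain x where x: "sat (a(v := x)) p" using \<open>sat a (Ex v p)\<close> by auto
    \<comment> \<open>Any bound for this particular \<open>b\<close> will do, because
      \<open>H'\<close>, \<open>M'\<close> and \<open>N'\<close> were chosen before it.\<close>
    obtain R where "\<forall>u\<in>?F. \<bar>b u\<bar> \<le> real R" using ex_bound[OF finite_free_vars[of "Ex v p"], of b] by blast
    then obtain y where y: "eqv (insert v ?F) H M (a(v := x)) (b(v := y))"
      "congr (insert v ?F) N (a(v := x)) (b(v := y))"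
      using forth[of R] \<open>eqv ?F H' M' a b\<close> \<open>congr ?F N' a b\<close> by blast
    have "free_vars p \<subseteq> insert v ?F" by auto
    then have "sat (b(v := y)) p"
      using p(3)[OF eqv_subset[OF y(1)] congr_subset[OF y(2)]] x finite_free_vars[of "Ex v p"] by simp
    then show ?thesis by auto
  qed
  then have "sat a (Ex v p) = sat b (Ex v p)" if "eqv ?F H' M' a b" "congr ?F N' a b" for a b
    using imp[OF that] imp[OF eqv_sym[OF that(1)] congr_sym[OF that(2)]] by blast
  then show ?case using H' by (intro exI[of _ H'] exI[of _ M'] exI[of _ N']) simp
qed

text \<open>On a bounded region an integer-valued form has only finitely many possible values, and
  each is recognised by a sign. Under a quantifier the witness may be unbounded; it is first
  replaced by a bounded one, and the induction hypothesis is then used with a larger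
  \<open>R\<close>.\<close>

lemma RZ_formula_bounded_sgneq:
  "One_sym \<notin> symbols p \<Longrightarrow> \<exists>H. \<forall>a b. (\<forall>v\<in>free_vars p. \<bar>a v\<bar> \<le> real R \<and> \<bar>b v\<bar> \<le> real R) \<longrightarrow>
     sgneq (free_vars p) H a b \<longrightarrow> sat a p = sat b p"
proof (induction p arbitrary: R)
  case (Eq s t)
  let ?F = "tm_vars s \<union> tm_vars t"
  obtain H c d where H: "small H c" "\<bar>d\<bar> \<le> int H"
    and st: "\<And>e. tm_val e s - tm_val e t = lin ?F c e + of_int d"
    using tm_val_diff[of s t] by auto
  have "sat a (Eq s t) = sat b (Eq s t)" if "sgneq ?F H a b" for a b
    using sgn_eq_iff(1)[OF sgneqD[OF that H]] st[of a] st[of b]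
    by (metis right_minus_eq sat.simps(1))
  then show ?case by auto
next
  case (Lt s t)
  let ?F = "tm_vars s \<union> tm_vars t"
  obtain H c d where H: "small H c" "\<bar>d\<bar> \<le> int H"
    and st: "\<And>e. tm_val e s - tm_val e t = lin ?F c e + of_int d"
    using tm_val_diff[of s t] by auto
  have "sat a (Lt s t) = sat b (Lt s t)" if "sgneq ?F H a b" for a b
    using sgn_eq_iff(2)[OF sgneqD[OF that H]] st[of a] st[of b]
    by (metis diff_less_0_iff_less sat.simps(2))
  then show ?case by auto
next
  case (Integer t)
  let ?F = "tm_vars t"
  obtain H where H: "small H (coef t)" using ex_small_coef by blast
  \<comment> \<open>The second summand bounds the form on the region, so each integer value it takes
    there is admissible as a constant term.\<close>
  define K where "K = H + card ?F * H * R"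
  have val: "tm_val e t = lin ?F (coef t) e" for e
    using tm_val_lin[OF finite_tm_vars subset_refl, of e t] const_eq_0[of t] Integer by simp
  have imp: "sat b (Integer t)" if "\<forall>v\<in>?F. \<bar>a v\<bar> \<le> real R" "sgneq ?F K a b" "sat a (Integer t)" for a b
  proof -
    obtain k where k: "lin ?F (coef t) a = of_int k" using \<open>sat a (Integer t)\<close> unfolding sat.simps val by (auto elim: Ints_cases)
    have "\<bar>lin ?F (coef t) a\<bar> \<le> real (card ?F) * real H * real R"
      using abs_lin_le[OF finite_tm_vars H] that(1) by blast
    then have "\<bar>of_int k\<bar> \<le> real (card ?F * H * R)" unfolding k by simp
    then have "\<bar>- k\<bar> \<le> int K" unfolding K_def by linarith
    moreover have "small K (coef t)" using H by (rule small_mono) (simp add: K_def)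
    ultimately have "lin ?F (coef t) b = of_int k"
      using sgn_eq_iff(1)[OF sgneqD[OF that(2)]] k by fastforce
    then show ?thesis unfolding sat.simps val by simp
  qed
  have "sat a (Integer t) = sat b (Integer t)"
    if "\<forall>v\<in>?F. \<bar>a v\<bar> \<le> real R \<and> \<bar>b v\<bar> \<le> real R" "sgneq ?F K a b" for a b
    using imp[OF _ that(2)] imp[OF _ sgneq_sym[OF that(2)]] that(1) by blast
  then show ?case by (intro exI[of _ K]) simp
next
  case (Neg p)
  then show ?case by simp
next
  case (Conj p q)
  obtain H where p: "\<And>a b. (\<forall>v\<in>free_vars p. \<bar>a v\<bar> \<le> real R \<and> \<bar>b v\<bar> \<le> real R) \<Longrightarrow> sgneq (free_vars p) H a b \<Longrightarrow> sat a p = sat b p"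
    using Conj.IH(1)[of R] Conj.prems by auto
  obtain H' where q: "\<And>a b. (\<forall>v\<in>free_vars q. \<bar>a v\<bar> \<le> real R \<and> \<bar>b v\<bar> \<le> real R) \<Longrightarrow> sgneq (free_vars q) H' a b \<Longrightarrow> sat a q = sat b q"
    using Conj.IH(2)[of R] Conj.prems by auto
  have "sat a (Conj p q) = sat b (Conj p q)"
    if "sgneq (free_vars (Conj p q)) (max H H') a b" "\<forall>v\<in>free_vars (Conj p q). \<bar>a v\<bar> \<le> real R \<and> \<bar>b v\<bar> \<le> real R" for a b
  proof -
    have e: "sgneq (free_vars p) H a b" "sgneq (free_vars q) H' a b"
      using sgneq_mono[OF sgneq_subset[OF that(1) finite_free_vars]] by auto
    show ?thesis using p[OF _ e(1)] q[OF _ e(2)] that(2) by auto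
  qed
  then show ?case by blast
next
  case (Ex v p)
  let ?F = "free_vars (Ex v p)"
  have fin: "finite ?F" and v: "v \<notin> ?F" and sub: "free_vars p \<subseteq> insert v ?F"
    using finite_free_vars by auto
  obtain H M N where p: "1 \<le> H" "1 \<le> N" "\<And>a b. eqv (free_vars p) H M a b \<Longrightarrow> congr (free_vars p) N a b \<Longrightarrow> sat a p = sat b p"
    using RZ_formula_invariant[of p] Ex.prems by auto
  obtain H' M' N' where forth: "\<And>R. \<exists>R'. \<forall>a b x. eqv ?F H' M' a b \<longrightarrow> congr ?F N' a b \<longrightarrow> (\<forall>u\<in>?F. \<bar>b u\<bar> \<le> real R) \<longrightarrow>
       (\<exists>y. \<bar>y\<bar> \<le> real R' \<and> eqv (insert v ?F) H M (a(v := x)) (b(v := y))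
           \<and> congr (insert v ?F) N (a(v := x)) (b(v := y)))"
    using forth[OF fin v p(1,2), of M] by metis
  \<comment> \<open>Here \<open>forth\<close> is played from \<open>a\<close> to itself, to exchange
    a witness for one of bounded size.\<close>
  obtain R' where R': "\<And>a x. (\<forall>u\<in>?F. \<bar>a u\<bar> \<le> real R) \<Longrightarrow>
       (\<exists>y. \<bar>y\<bar> \<le> real R' \<and> eqv (insert v ?F) H M (a(v := x)) (a(v := y))
           \<and> congr (insert v ?F) N (a(v := x)) (a(v := y)))"
    using forth[of R] eqv_refl congr_refl by metis
  define R'' where "R'' = max R R'"
  obtain H1 where H1: "\<And>a b. (\<forall>v\<in>free_vars p. \<bar>a v\<bar> \<le> real R'' \<and> \<bar>b v\<bar> \<le> real R'') \<Longrightarrow>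
     sgneq (free_vars p) H1 a b \<Longrightarrow> sat a p = sat b p"
    using Ex.IH[of R''] Ex.prems by auto
  \<comment> \<open>Includes \<open>R''\<close> so that the answer \<open>z\<close> over
    \<open>b\<close> inherits the bound on the witness \<open>y\<close>.\<close>
  define K where "K = max 1 (max H1 R'')"
  have imp: "sat b (Ex v p)" if bd: "\<forall>u\<in>?F. \<bar>a u\<bar> \<le> real R \<and> \<bar>b u\<bar> \<le> real R"
    and ab: "sgneq ?F (2 * K * K) a b" and "sat a (Ex v p)" for a b
  proof -
    obtain x where x: "sat (a(v := x)) p" using \<open>sat a (Ex v p)\<close> by auto
    obtain y where y: "\<bar>y\<bar> \<le> real R'" "eqv (insert v ?F) H M (a(v := x)) (a(v := y))"
      "congr (insert v ?F) N (a(v := x)) (a(v := y))" using R'[of a x] bd by blast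
    have ay: "sat (a(v := y)) p"
      using p(3) x eqv_subset[OF y(2) _ sub] congr_subset[OF y(3) sub] fin by blast
    obtain z where z: "sgneq (insert v ?F) K (a(v := y)) (b(v := z))"
      using sgneq_forth[OF fin v ab] by blast
    have "\<bar>(a(v := y)) v\<bar> \<le> real R''" using y(1) by (simp add: R''_def)
    then have "\<bar>(b(v := z)) v\<bar> \<le> real R''"
      using sgneq_abs_le[OF _ _ z, of v R''] fin by (auto simp: K_def)
    then have zb: "\<bar>z\<bar> \<le> real R''" by simp
    have bd': "\<forall>u\<in>free_vars p. \<bar>(a(v := y)) u\<bar> \<le> real R'' \<and> \<bar>(b(v := z)) u\<bar> \<le> real R''"
    proof
      fix u assume "u \<in> free_vars p"
      then have "u = v \<or> u \<noteq> v \<and> \<bar>a u\<bar> \<le> real R \<and> \<bar>b u\<bar> \<le> real R" using bd by auto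
      then show "\<bar>(a(v := y)) u\<bar> \<le> real R'' \<and> \<bar>(b(v := z)) u\<bar> \<le> real R''"
        using zb y(1) by (auto simp: R''_def)
    qed
    have "sgneq (free_vars p) H1 (a(v := y)) (b(v := z))"
      using sgneq_mono[OF sgneq_subset[OF z _ sub]] fin by (simp add: K_def)
    then have "sat (b(v := z)) p" using H1[of "a(v := y)" "b(v := z)"] bd' ay by blast
    then show ?thesis by auto
  qed
  have "sat a (Ex v p) = sat b (Ex v p)"
    if "\<forall>v\<in>?F. \<bar>a v\<bar> \<le> real R \<and> \<bar>b v\<bar> \<le> real R" "sgneq ?F (2 * K * K) a b" for a b
    using imp[OF _ that(2)] imp[OF _ sgneq_sym[OF that(2)]] that(1) by blast
  then show ?case by (intro exI[of _ "2 * K * K"] allI impI)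
qed

lemma R1_formula_sgneq:
  "Int_sym \<notin> symbols p \<Longrightarrow> \<exists>H. \<forall>a b. sgneq (free_vars p) H a b \<longrightarrow> sat a p = sat b p"
proof (induction p)
  case (Eq s t)
  let ?F = "tm_vars s \<union> tm_vars t"
  obtain H c d where H: "small H c" "\<bar>d\<bar> \<le> int H"
    and st: "\<And>e. tm_val e s - tm_val e t = lin ?F c e + of_int d"
    using tm_val_diff[of s t] by auto
  have "sat a (Eq s t) = sat b (Eq s t)" if "sgneq ?F H a b" for a b
    using sgn_eq_iff(1)[OF sgneqD[OF that H]] st[of a] st[of b]
    by (metis right_minus_eq sat.simps(1))
  then show ?case by auto
next
  case (Lt s t)
  let ?F = "tm_vars s \<union> tm_vars t"
  obtain H c d where H: "small H c" "\<bar>d\<bar> \<le> int H"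
    and st: "\<And>e. tm_val e s - tm_val e t = lin ?F c e + of_int d"
    using tm_val_diff[of s t] by auto
  have "sat a (Lt s t) = sat b (Lt s t)" if "sgneq ?F H a b" for a b
    using sgn_eq_iff(2)[OF sgneqD[OF that H]] st[of a] st[of b]
    by (metis diff_less_0_iff_less sat.simps(2))
  then show ?case by auto
next
  case (Integer t)
  then show ?case by simp
next
  case (Neg p)
  then show ?case by simp
next
  case (Conj p q)
  obtain H where p: "\<And>a b. sgneq (free_vars p) H a b \<Longrightarrow> sat a p = sat b p"
    using Conj by auto
  obtain H' where q: "\<And>a b. sgneq (free_vars q) H' a b \<Longrightarrow> sat a q = sat b q"
    using Conj by auto
  have "sat a (Conj p q) = sat b (Conj p q)"
    if "sgneq (free_vars (Conj p q)) (max H H') a b" for a b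
  proof -
    have e: "sgneq (free_vars p) H a b" "sgneq (free_vars q) H' a b"
      using sgneq_mono[OF sgneq_subset[OF that(1) finite_free_vars]] by auto
    show ?thesis using p[OF e(1)] q[OF e(2)] by simp
  qed
  then show ?case by blast
next
  case (Ex v p)
  let ?F = "free_vars (Ex v p)"
  have fin: "finite ?F" and v: "v \<notin> ?F" and sub: "free_vars p \<subseteq> insert v ?F"
    using finite_free_vars by auto
  obtain H where H: "\<And>a b. sgneq (free_vars p) H a b \<Longrightarrow> sat a p = sat b p" using Ex by auto
  have imp: "sat b (Ex v p)" if ab: "sgneq ?F (2 * H * H) a b" and "sat a (Ex v p)" for a b
  proof -
    obtain x where x: "sat (a(v := x)) p" using \<open>sat a (Ex v p)\<close> by auto
    obtain z where z: "sgneq (insert v ?F) H (a(v := x)) (b(v := z))"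
      using sgneq_forth[OF fin v ab] by blast
    then have "sat (b(v := z)) p" using H sgneq_subset[OF z _ sub] fin x by blast
    then show ?thesis by auto
  qed
  have "sat a (Ex v p) = sat b (Ex v p)" if "sgneq ?F (2 * H * H) a b" for a b
    using imp[OF that] imp[OF sgneq_sym[OF that]] by blast
  then show ?case by (intro exI[of _ "2 * H * H"] allI impI)
qed

subsection \<open>Definable sets and rational lines\<close>

lemma finite_small: "finite {c :: 'n::finite \<Rightarrow> int. small H c}"
proof -
  have "{c :: 'n \<Rightarrow> int. small H c} \<subseteq> {c. \<forall>v. (v \<in> UNIV \<longrightarrow> c v \<in> {- int H..int H}) \<and> (v \<notin> UNIV \<longrightarrow> c v = 0)}"
    by (auto simp: small_def abs_le_iff minus_le_iff)
  then show ?thesis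
    using finite_set_of_finite_funs[of "UNIV :: 'n set" "{- int H..int H}" 0] finite_subset by fastforce
qed

lemma eventually_sgn_affine:
  fixes p q :: real
  shows "\<forall>\<^sub>F t in at_top. sgn (p + t * q) = (if q = 0 then sgn p else sgn q)"
proof (cases "q = 0")
  case False
  have "sgn (p + t * q) = sgn q" if "t > \<bar>p\<bar> / \<bar>q\<bar>" for t
  proof -
    have "\<bar>p\<bar> < t * \<bar>q\<bar>" using that False by (simp add: field_simps)
    then show ?thesis using False by (cases "q > 0") (auto simp: sgn_real_def)
  qed
  then have "\<forall>\<^sub>F t in at_top. sgn (p + t * q) = sgn q"
    by (rule eventually_mono[OF eventually_gt_at_top])
  then show ?thesis using False by simp
qed simp

text \<open>The sign of a form is eventually that of its slope along the ray, or constant if the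
  slope is zero, and there are finitely many forms. Hence an \<open>R1_definable\<close> set is
  eventually constant along every ray.\<close>

lemma sgneq_ray:
  fixes a u :: "'n::finite \<Rightarrow> real"
  shows "\<exists>t0. \<forall>t\<ge>t0. \<forall>t'\<ge>t0. sgneq UNIV H (\<lambda>v. a v + t * u v) (\<lambda>v. a v + t' * u v)"
proof -
  let ?s = "\<lambda>t c d. sgn (lin UNIV c (\<lambda>v. a v + t * u v) + of_int d)"
  let ?r = "\<lambda>c d. if lin UNIV c u = 0 then sgn (lin UNIV c a + of_int d) else sgn (lin UNIV c u)"
  have "\<forall>\<^sub>F t in at_top. ?s t c d = ?r c d" for c and d :: int
    using eventually_sgn_affine[of "lin UNIV c a + of_int d" "lin UNIV c u"]
    by (simp add: lin_add lin_scale algebra_simps)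
  then have "\<forall>\<^sub>F t in at_top. \<forall>c\<in>{c. small H c}. \<forall>d\<in>{- int H..int H}. ?s t c d = ?r c d"
    by (intro eventually_ball_finite finite_small ballI) auto
  then obtain t0 where "\<And>t. t \<ge> t0 \<Longrightarrow> \<forall>c\<in>{c. small H c}. \<forall>d\<in>{- int H..int H}. ?s t c d = ?r c d"
    unfolding eventually_at_top_linorder by blast
  then have "?s t c d = ?r c d" if "t \<ge> t0" "small H c" "\<bar>d\<bar> \<le> int H" for t c d
    using that by (simp add: abs_le_iff minus_le_iff)
  then show ?thesis unfolding sgneq_def by (intro exI[of _ t0]) simp
qed

lemma lin_Inl: "lin (range Inl) c (case_sum f w) = lin UNIV (c \<circ> Inl) f"
  unfolding lin_def by (subst sum.reindex) auto

lemma small_comp: "small H c \<Longrightarrow> small H (c \<circ> g)"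
  by (simp add: small_def)

lemma eqv_Inl: "eqv UNIV H M f g \<Longrightarrow> eqv (range Inl) H M (case_sum f w) (case_sum g w')"
  by (simp add: eqv_def lin_Inl small_comp)

lemma congr_Inl: "congr UNIV N f g \<Longrightarrow> congr (range Inl) N (case_sum f w) (case_sum g w')"
  by (auto simp: congr_def)

lemma sgneq_Inl: "sgneq UNIV H f g \<Longrightarrow> sgneq (range Inl) H (case_sum f w) (case_sum g w')"
  by (simp add: sgneq_def lin_Inl small_comp)

lemma RZ_definable_invariant:
  assumes "RZ_definable (X :: (real ^ 'n) set)"
  shows "\<exists>H M N. 1 \<le> H \<and> 1 \<le> N \<and> (\<forall>a b. eqv UNIV H M (($) a) (($) b) \<longrightarrow>
           congr UNIV N (($) a) (($) b) \<longrightarrow> (a \<in> X \<longleftrightarrow> b \<in> X))"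
proof -
  obtain p :: "('n + nat) rfm" where p: "symbols p \<subseteq> {Add_sym, Lt_sym, Int_sym}" "free_vars p \<subseteq> range Inl"
    and X: "\<And>a w. sat (case_sum (($) a) w) p \<longleftrightarrow> a \<in> X" using assms unfolding definable_def by blast
  have "One_sym \<notin> symbols p" using p(1) by auto
  then obtain H M N where H: "1 \<le> H" "1 \<le> N"
    and inv: "\<And>a b. eqv (free_vars p) H M a b \<Longrightarrow> congr (free_vars p) N a b \<Longrightarrow> sat a p = sat b p"
    using RZ_formula_invariant by blast
  have "a \<in> X \<longleftrightarrow> b \<in> X" if "eqv UNIV H M (($) a) (($) b)" "congr UNIV N (($) a) (($) b)" for a b
    using inv[OF eqv_subset[OF eqv_Inl[OF that(1)] _ p(2)] congr_subset[OF congr_Inl[OF that(2)] p(2)]] X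
    by simp
  then show ?thesis using H by blast
qed

lemma RZ_definable_bounded_sgneq:
  assumes "RZ_definable (X :: (real ^ 'n) set)"
  shows "\<exists>H. \<forall>a b. (\<forall>i. \<bar>a $ i\<bar> \<le> real R \<and> \<bar>b $ i\<bar> \<le> real R) \<longrightarrow>
           sgneq UNIV H (($) a) (($) b) \<longrightarrow> (a \<in> X \<longleftrightarrow> b \<in> X)"
proof -
  obtain p :: "('n + nat) rfm" where p: "symbols p \<subseteq> {Add_sym, Lt_sym, Int_sym}" "free_vars p \<subseteq> range Inl"
    and X: "\<And>a w. sat (case_sum (($) a) w) p \<longleftrightarrow> a \<in> X" using assms unfolding definable_def by blast
  have "One_sym \<notin> symbols p" using p(1) by auto
  then obtain H where inv: "\<And>a b. (\<forall>v\<in>free_vars p. \<bar>a v\<bar> \<le> real R \<and> \<bar>b v\<bar> \<le> real R) \<Longrightarrow>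
      sgneq (free_vars p) H a b \<Longrightarrow> sat a p = sat b p"
    using RZ_formula_bounded_sgneq by blast
  have "a \<in> X \<longleftrightarrow> b \<in> X" if "\<forall>i. \<bar>a $ i\<bar> \<le> real R \<and> \<bar>b $ i\<bar> \<le> real R" "sgneq UNIV H (($) a) (($) b)" for a b
  proof -
    have "\<forall>v\<in>free_vars p. \<bar>case_sum (($) a) (\<lambda>_. 0) v\<bar> \<le> real R \<and> \<bar>case_sum (($) b) (\<lambda>_. 0) v\<bar> \<le> real R"
      using p(2) that(1) by auto
    then show ?thesis using inv[OF _ sgneq_subset[OF sgneq_Inl[OF that(2)] _ p(2)]] X by simp
  qed
  then show ?thesis by blast
qed

lemma R1_definable_sgneq:
  assumes "R1_definable (X :: (real ^ 'n) set)"
  shows "\<exists>H. \<forall>a b. sgneq UNIV H (($) a) (($) b) \<longrightarrow> (a \<in> X \<longleftrightarrow> b \<in> X)"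
proof -
  obtain p :: "('n + nat) rfm" where p: "symbols p \<subseteq> {Add_sym, Lt_sym, One_sym}" "free_vars p \<subseteq> range Inl"
    and X: "\<And>a w. sat (case_sum (($) a) w) p \<longleftrightarrow> a \<in> X" using assms unfolding definable_def by blast
  have "Int_sym \<notin> symbols p" using p(1) by auto
  then obtain H where inv: "\<And>a b. sgneq (free_vars p) H a b \<Longrightarrow> sat a p = sat b p"
    using R1_formula_sgneq by blast
  have "a \<in> X \<longleftrightarrow> b \<in> X" if "sgneq UNIV H (($) a) (($) b)" for a b
    using inv[OF sgneq_subset[OF sgneq_Inl[OF that] _ p(2)]] X by simp
  then show ?thesis by blast
qed

section \<open>Boolean closure and definability from finitely many signs\<close>

lemma definable_Compl: assumes "definable S X" shows "definable S (- X)"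
proof -
  obtain p :: "('a + nat) rfm" where "symbols p \<subseteq> S" "free_vars p \<subseteq> range Inl"
    "\<And>a w. sat (case_sum (($) a) w) p \<longleftrightarrow> a \<in> X" using assms unfolding definable_def by blast
  then show ?thesis unfolding definable_def by (intro exI[of _ "Neg p"]) simp
qed

lemma definable_Int: assumes "definable S X" "definable S Y" shows "definable S (X \<inter> Y)"
proof -
  obtain p :: "('a + nat) rfm" where "symbols p \<subseteq> S" "free_vars p \<subseteq> range Inl"
    "\<And>a w. sat (case_sum (($) a) w) p \<longleftrightarrow> a \<in> X" using assms(1) unfolding definable_def by blast
  moreover obtain q :: "('a + nat) rfm" where "symbols q \<subseteq> S" "free_vars q \<subseteq> range Inl"
    "\<And>a w. sat (case_sum (($) a) w) q \<longleftrightarrow> a \<in> Y" using assms(2) unfolding definable_def by blast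
  ultimately show ?thesis unfolding definable_def by (intro exI[of _ "Conj p q"]) simp
qed

lemma definable_Un: assumes "definable S X" "definable S Y" shows "definable S (X \<union> Y)"
proof -
  have "X \<union> Y = - (- X \<inter> - Y)" by blast
  then show ?thesis using assms definable_Compl definable_Int by metis
qed

lemma R1_definable_UNIV: "R1_definable UNIV"
  unfolding definable_def by (intro exI[of _ "Eq One One"]) simp

lemma R1_definable_Inter: "finite \<A> \<Longrightarrow> (\<And>A. A \<in> \<A> \<Longrightarrow> R1_definable A) \<Longrightarrow> R1_definable (\<Inter>\<A>)"
  by (induction \<A> rule: finite_induct) (auto simp: R1_definable_UNIV intro: definable_Int)

text \<open>Such an \<open>X\<close> is a Boolean combination of the members of \<open>\<A>\<close>.
  Splitting along one member at a time avoids writing down the atoms of the Boolean algebra.\<close>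

lemma R1_definable_if_separated:
  assumes "finite \<A>" "\<And>A. A \<in> \<A> \<Longrightarrow> R1_definable A"
    and "\<And>a b. (\<And>A. A \<in> \<A> \<Longrightarrow> a \<in> A \<longleftrightarrow> b \<in> A) \<Longrightarrow> a \<in> X \<longleftrightarrow> b \<in> X"
  shows "R1_definable X"
  using assms
proof (induction \<A> arbitrary: X rule: finite_induct)
  case empty
  then have "X = UNIV \<or> X = - UNIV" by blast
  then show ?case using R1_definable_UNIV definable_Compl by metis
next
  case (insert A \<A>)
  \<comment> \<open>The saturation of \<open>Y \<inter> X\<close> under the remaining sets. Within
    \<open>A\<close> the set \<open>cls A\<close> coincides with \<open>X\<close>, and within
    \<open>- A\<close> so does \<open>cls (- A)\<close>; the induction hypothesis covers
    both.\<close>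
  define cls where "cls Y = {a. \<exists>b\<in>Y \<inter> X. \<forall>B\<in>\<A>. a \<in> B \<longleftrightarrow> b \<in> B}" for Y
  have cls: "R1_definable (cls Y)" for Y
  proof (rule insert.IH)
    show "R1_definable B" if "B \<in> \<A>" for B using insert.prems(1) that by simp
    show "a \<in> cls Y \<longleftrightarrow> b \<in> cls Y" if "\<And>B. B \<in> \<A> \<Longrightarrow> a \<in> B \<longleftrightarrow> b \<in> B" for a b
      unfolding cls_def using that by simp
  qed
  have sep: "a \<in> X \<longleftrightarrow> b \<in> X" if "a \<in> A \<longleftrightarrow> b \<in> A" "\<forall>B\<in>\<A>. a \<in> B \<longleftrightarrow> b \<in> B" for a b
    using insert.prems(2)[of a b] that by blast
  have "X = (A \<inter> cls A) \<union> (- A \<inter> cls (- A))"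
  proof (intro set_eqI)
    fix a
    show "a \<in> X \<longleftrightarrow> a \<in> (A \<inter> cls A) \<union> (- A \<inter> cls (- A))"
      unfolding cls_def using sep[of a] by blast
  qed
  moreover have A: "R1_definable A" using insert.prems(1) by simp
  ultimately show ?case
    using definable_Un[OF definable_Int[OF A cls] definable_Int[OF definable_Compl[OF A] cls]] by metis
qed

text \<open>There is no term for \<open>0\<close> or for a negative number, so an affine form is a difference of two terms.\<close>

definition term_diff :: "((('n + nat) \<Rightarrow> real) \<Rightarrow> real) \<Rightarrow> bool" where
  "term_diff g \<longleftrightarrow> (\<exists>s t. tm_symbols s \<union> tm_symbols t \<subseteq> {Add_sym, One_sym} \<and>
     tm_vars s \<union> tm_vars t \<subseteq> range Inl \<and> (\<forall>e. tm_val e s - tm_val e t = g e))"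

lemma term_diff_Var: "term_diff (\<lambda>e. e (Inl i))"
  unfolding term_diff_def by (intro exI[of _ "Add (Var (Inl i)) One"] exI[of _ One]) simp

lemma term_diff_0: "term_diff (\<lambda>e. 0)"
  unfolding term_diff_def by (intro exI[of _ One]) simp

lemma term_diff_1: "term_diff (\<lambda>e. 1)"
  unfolding term_diff_def by (intro exI[of _ "Add One One"] exI[of _ One]) simp

lemma term_diff_add: assumes "term_diff g" "term_diff h" shows "term_diff (\<lambda>e. g e + h e)"
proof -
  obtain s t where "tm_symbols s \<union> tm_symbols t \<subseteq> {Add_sym, One_sym}"
     "tm_vars s \<union> tm_vars t \<subseteq> range Inl" "\<And>e. tm_val e s - tm_val e t = g e"
    using assms(1) unfolding term_diff_def by blast
  moreover obtain s' t' where "tm_symbols s' \<union> tm_symbols t' \<subseteq> {Add_sym, One_sym}"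
     "tm_vars s' \<union> tm_vars t' \<subseteq> range Inl" "\<And>e. tm_val e s' - tm_val e t' = h e"
    using assms(2) unfolding term_diff_def by blast
  moreover from this have "tm_val e (Add s s') - tm_val e (Add t t')
      = (tm_val e s - tm_val e t) + (tm_val e s' - tm_val e t')" for e by simp
  ultimately show ?thesis
    unfolding term_diff_def by (intro exI[of _ "Add s s'"] exI[of _ "Add t t'"]) simp
qed

lemma term_diff_uminus: assumes "term_diff g" shows "term_diff (\<lambda>e. - g e)"
proof -
  obtain s t where "tm_symbols s \<union> tm_symbols t \<subseteq> {Add_sym, One_sym}"
     "tm_vars s \<union> tm_vars t \<subseteq> range Inl" and val: "\<And>e. tm_val e s - tm_val e t = g e"
    using assms(1) unfolding term_diff_def by blast
  moreover have "tm_val e t - tm_val e s = - g e" for e using val[of e] by simp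
  ultimately show ?thesis
    unfolding term_diff_def by (intro exI[of _ t] exI[of _ s]) auto
qed

lemma term_diff_of_nat: assumes "term_diff g" shows "term_diff (\<lambda>e. of_nat k * g e)"
proof (induction k)
  case (Suc k)
  then show ?case using term_diff_add[OF assms Suc] by (simp add: algebra_simps)
qed (simp add: term_diff_0)

lemma term_diff_of_int: assumes "term_diff g" shows "term_diff (\<lambda>e. of_int k * g e)"
  using term_diff_of_nat[OF assms] term_diff_uminus[OF term_diff_of_nat[OF assms]]
  by (cases k rule: int_cases2) auto

lemma term_diff_sum:
  "finite I \<Longrightarrow> (\<And>i. i \<in> I \<Longrightarrow> term_diff (g i)) \<Longrightarrow> term_diff (\<lambda>e. \<Sum>i\<in>I. g i e)"
  by (induction I rule: finite_induct) (auto intro: term_diff_0 term_diff_add)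

lemma R1_definable_atoms:
  fixes c :: "'n::finite \<Rightarrow> int" and d :: int
  shows "R1_definable {a. lin UNIV c (($) a) + of_int d = 0}" (is ?eq)
    and "R1_definable {a. lin UNIV c (($) a) + of_int d < 0}" (is ?lt)
proof -
  have "term_diff (\<lambda>e. (\<Sum>i\<in>UNIV. of_int (c i) * e (Inl i)) + of_int d * 1)"
    by (intro term_diff_add term_diff_sum term_diff_of_int term_diff_Var term_diff_1) simp
  then obtain s t :: "('n + nat) rtm" where st: "tm_symbols s \<union> tm_symbols t \<subseteq> {Add_sym, One_sym}"
     "tm_vars s \<union> tm_vars t \<subseteq> range Inl"
    and "\<And>e. tm_val e s - tm_val e t = (\<Sum>i\<in>UNIV. of_int (c i) * e (Inl i)) + of_int d * 1"
    unfolding term_diff_def by blast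
  then have val: "tm_val (case_sum (($) a) w) s - tm_val (case_sum (($) a) w) t = lin UNIV c (($) a) + of_int d"
    for a :: "real ^ 'n" and w by (simp add: lin_def)
  have eq: "tm_val (case_sum (($) a) w) s = tm_val (case_sum (($) a) w) t \<longleftrightarrow> lin UNIV c (($) a) + of_int d = 0"
    and lt: "tm_val (case_sum (($) a) w) s < tm_val (case_sum (($) a) w) t \<longleftrightarrow> lin UNIV c (($) a) + of_int d < 0"
    for a w using val[of a w] by linarith+
  show ?eq unfolding definable_def using st by (intro exI[of _ "Eq s t"]) (auto simp: eq)
  show ?lt unfolding definable_def using st by (intro exI[of _ "Lt s t"]) (auto simp: lt)
qed

text \<open>The zero sets and negative half-spaces of the finitely many forms determine all three
  signs, so they separate \<open>X\<close> from its complement.\<close>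

lemma R1_definable_if_sgneq:
  fixes X :: "(real ^ 'n) set"
  assumes "\<And>a b. sgneq UNIV H (($) a) (($) b) \<Longrightarrow> a \<in> X \<longleftrightarrow> b \<in> X"
  shows "R1_definable X"
proof -
  define E where "E = (\<lambda>(c, d). {a :: real ^ 'n. lin UNIV c (($) a) + of_int d = 0})"
  define L where "L = (\<lambda>(c, d). {a :: real ^ 'n. lin UNIV c (($) a) + of_int d < 0})"
  define P where "P = {c :: 'n \<Rightarrow> int. small H c} \<times> {- int H..int H}"
  show ?thesis
  proof (rule R1_definable_if_separated)
    show "finite (E ` P \<union> L ` P)" unfolding P_def using finite_small by blast
    show "R1_definable A" if "A \<in> E ` P \<union> L ` P" for A
      using that R1_definable_atoms by (auto simp: E_def L_def)
  next
    fix a b :: "real ^ 'n" assume sep: "\<And>A. A \<in> E ` P \<union> L ` P \<Longrightarrow> a \<in> A \<longleftrightarrow> b \<in> A"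
    have "sgneq UNIV H (($) a) (($) b)"
      unfolding sgneq_def
    proof (intro allI impI)
      fix c :: "'n \<Rightarrow> int" and d :: int assume "small H c" "\<bar>d\<bar> \<le> int H"
      then have "(c, d) \<in> P" by (auto simp: P_def abs_le_iff)
      then have "a \<in> E (c, d) \<longleftrightarrow> b \<in> E (c, d)" "a \<in> L (c, d) \<longleftrightarrow> b \<in> L (c, d)"
        using sep by blast+
      then show "sgn (lin UNIV c (($) a) + of_int d) = sgn (lin UNIV c (($) b) + of_int d)"
        by (auto simp: E_def L_def sgn_real_def)
    qed
    then show "a \<in> X \<longleftrightarrow> b \<in> X" by (rule assms)
  qed
qed

section \<open>Rational hyperplanes and rational lines\<close>

lemma ex_common_denominator:
  assumes "finite F" "\<And>v. v \<in> F \<Longrightarrow> f v \<in> \<rat>"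
  shows "\<exists>q\<ge>1. \<forall>v\<in>F. real q * f v \<in> \<int>"
  using assms
proof (induction F)
  case (insert v F)
  then obtain q where q: "q \<ge> 1" "\<forall>v\<in>F. real q * f v \<in> \<int>" by auto
  obtain i :: int and n :: nat where n: "n \<noteq> 0" "f v = of_int i / real n"
    using insert.prems[of v] unfolding Rats_eq_int_div_nat by auto
  have "real (n * q) * f u \<in> \<int>" if "u \<in> F" for u
  proof -
    have "real n * (real q * f u) \<in> \<int>" using q(2) that by (simp only: Ints_mult Ints_of_nat)
    then show ?thesis by (simp add: mult.assoc)
  qed
  moreover have "real (n * q) * f v \<in> \<int>" using n by simp
  ultimately show ?case using n(1) q(1) by (intro exI[of _ "n * q"]) auto
qed auto

lemma R1_definable_rational_hyperplane:
  assumes "rational_hyperplane (A :: (real ^ 'n) set)" shows "R1_definable A"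
proof -
  obtain a :: "real ^ 'n" and b where ab: "\<And>i. a $ i \<in> \<rat>" "b \<in> \<rat>" and A: "A = {x. a \<bullet> x = b}"
    using assms unfolding rational_hyperplane_def by blast
  \<comment> \<open>The index \<open>None\<close> stands for the right-hand side \<open>b\<close>,
    so one denominator clears the normal vector and \<open>b\<close> together.\<close>
  have "\<exists>q\<ge>1. \<forall>v\<in>UNIV. real q * (case v of None \<Rightarrow> b | Some i \<Rightarrow> a $ i) \<in> \<int>"
    by (rule ex_common_denominator) (use ab in \<open>auto split: option.split\<close>)
  then obtain q where q: "q \<ge> 1" and "\<And>v. real q * (case v of None \<Rightarrow> b | Some i \<Rightarrow> a $ i) \<in> \<int>"
    by blast
  from this(2)[of None] this(2)[of "Some _"] have "real q * b \<in> \<int>" "\<And>i. real q * a $ i \<in> \<int>" by auto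
  then have "\<exists>d. real q * b = of_int d" "\<forall>i. \<exists>k. real q * a $ i = of_int k"
    by (auto simp: Ints_def)
  then obtain d c where d: "real q * b = of_int d" and c: "\<And>i. real q * a $ i = of_int (c i)"
    unfolding choice_iff by blast
  have "a \<bullet> x = b \<longleftrightarrow> lin UNIV c (($) x) + of_int (- d) = 0" for x
  proof -
    have "lin UNIV c (($) x) = real q * (a \<bullet> x)"
      by (simp add: lin_def inner_vec_def sum_distrib_left c[symmetric] mult.assoc)
    then have "lin UNIV c (($) x) + of_int (- d) = real q * (a \<bullet> x - b)"
      by (simp add: d[symmetric] algebra_simps)
    then show ?thesis using q by simp
  qed
  then show ?thesis using R1_definable_atoms(1)[of c "- d"] A by simp
qed

text \<open>A rational line may be given by infinitely many hyperplanes, whereas a formula can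
  mention finitely many. A finite subfamily whose intersection has least dimension suffices: a
  further member could only cut it down to an affine subspace of the same dimension, hence not at
  all.\<close>

lemma affine_Inter_eq_finite:
  fixes \<H> :: "('a::euclidean_space) set set"
  assumes "\<And>A. A \<in> \<H> \<Longrightarrow> affine A" "\<Inter>\<H> \<noteq> {}"
  shows "\<exists>\<F>\<subseteq>\<H>. finite \<F> \<and> \<Inter>\<F> = \<Inter>\<H>"
proof -
  have "\<exists>\<F>. (finite \<F> \<and> \<F> \<subseteq> \<H>) \<and> (\<forall>\<G>. finite \<G> \<and> \<G> \<subseteq> \<H> \<longrightarrow> nat (aff_dim (\<Inter>\<F>)) \<le> nat (aff_dim (\<Inter>\<G>)))"
    by (rule ex_has_least_nat[of _ "{}"]) simp
  then obtain \<F> where F: "finite \<F>" "\<F> \<subseteq> \<H>"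
    and min: "\<And>\<G>. finite \<G> \<Longrightarrow> \<G> \<subseteq> \<H> \<Longrightarrow> nat (aff_dim (\<Inter>\<F>)) \<le> nat (aff_dim (\<Inter>\<G>))" by blast
  have "\<Inter>\<F> \<subseteq> A" if "A \<in> \<H>" for A
  proof -
    have ne: "\<Inter>(insert A \<F>) \<noteq> {}" using assms(2) F(2) that by blast
    have sub: "\<Inter>(insert A \<F>) \<subseteq> \<Inter>\<F>" by blast
    have aff: "affine (\<Inter>\<F>)" "affine (\<Inter>(insert A \<F>))"
      by (intro affine_Inter ballI; use assms(1) F that in blast)+
    have "nat (aff_dim (\<Inter>\<F>)) \<le> nat (aff_dim (\<Inter>(insert A \<F>)))"
      using F that by (intro min) auto
    \<comment> \<open>Nonemptiness excludes dimension -1, so comparing dimensions through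
      \<open>nat\<close> loses nothing.\<close>
    moreover have "0 \<le> aff_dim (\<Inter>(insert A \<F>))" using ne aff_dim_empty[of "\<Inter>(insert A \<F>)"] aff_dim_geq[of "\<Inter>(insert A \<F>)"] by linarith
    ultimately have "aff_dim (\<Inter>(insert A \<F>)) = aff_dim (\<Inter>\<F>)"
      using aff_dim_subset[OF sub] by linarith
    then have "\<Inter>(insert A \<F>) = \<Inter>\<F>" using affine_dim_equal[OF aff(2,1) ne sub] by simp
    then show ?thesis by blast
  qed
  then have "\<Inter>\<F> = \<Inter>\<H>" using F(2) by blast
  then show ?thesis using F by blast
qed

lemma R1_definable_rational_line:
  assumes "rational_line (L :: (real ^ 'n) set)" shows "R1_definable L"
proof -
  obtain \<H> where H: "\<And>A. A \<in> \<H> \<Longrightarrow> rational_hyperplane A" and L: "L = \<Inter>\<H>" and dim: "aff_dim L = 1"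
    using assms unfolding rational_line_def by blast
  have "affine A" if "A \<in> \<H>" for A
    using H[OF that] unfolding rational_hyperplane_def by (auto simp: affine_hyperplane)
  moreover have "\<Inter>\<H> \<noteq> {}" using dim L by auto
  ultimately obtain \<F> where "\<F> \<subseteq> \<H>" "finite \<F>" "\<Inter>\<F> = L" using affine_Inter_eq_finite L by metis
  then show ?thesis using R1_definable_Inter[of \<F>] R1_definable_rational_hyperplane H by blast
qed

text \<open>With \<open>u $ k\<close> nonzero, the coordinate \<open>k\<close> determines the
  parameter, and each other coordinate \<open>j\<close> contributes the equation that
  \<open>x - a\<close> and \<open>u\<close> are proportional in the coordinates \<open>j\<close> and
  \<open>k\<close>. In dimension 1 this family is empty and its intersection is the whole
  line.\<close>

lemma rational_line_param:
  fixes a u :: "real ^ 'n"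
  assumes a: "\<And>i. a $ i \<in> \<rat>" and u: "\<And>i. u $ i \<in> \<rat>" and "u \<noteq> 0"
  shows "rational_line (range (\<lambda>t. a + t *\<^sub>R u))"
proof -
  let ?L = "range (\<lambda>t. a + t *\<^sub>R u)"
  have hull: "?L = affine hull {a, a + u}"
  proof -
    have *: "r *\<^sub>R a + t *\<^sub>R (a + u) = a + t *\<^sub>R u" if "r + t = 1" for r t
    proof -
      have "r *\<^sub>R a + t *\<^sub>R (a + u) = (r + t) *\<^sub>R a + t *\<^sub>R u"
        by (simp add: scaleR_add_left scaleR_add_right)
      then show ?thesis using that by simp
    qed
    show ?thesis unfolding affine_hull_2
    proof (intro equalityI subsetI)
      fix x assume "x \<in> ?L"
      then obtain t where "x = a + t *\<^sub>R u" by blast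
      then have "x = (1 - t) *\<^sub>R a + t *\<^sub>R (a + u)" using *[of "1 - t" t] by simp
      then show "x \<in> {r *\<^sub>R a + t *\<^sub>R (a + u) |r t. r + t = 1}"
        by (intro CollectI exI[of _ "1 - t"] exI[of _ t]) simp
    qed (auto simp: *)
  qed
  have aff: "affine ?L" "aff_dim ?L = 1"
    unfolding hull using \<open>u \<noteq> 0\<close> by (simp_all add: affine_affine_hull aff_dim_2)
  obtain k where k: "u $ k \<noteq> 0" using \<open>u \<noteq> 0\<close> by (metis vec_eq_iff zero_index)
  define n where "n j = (\<chi> i. if i = j then u $ k else if i = k then - u $ j else 0)" for j
  have inner: "n j \<bullet> x = u $ k * x $ j - u $ j * x $ k" if "j \<noteq> k" for j x
  proof -
    have "n j \<bullet> x = (\<Sum>i\<in>UNIV. (if i = j then u $ k * x $ j else 0) + (if i = k then - (u $ j * x $ k) else 0))"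
      unfolding inner_vec_def n_def using that by (intro sum.cong) auto
    then show ?thesis by (simp add: sum.distrib)
  qed
  define \<H> where "\<H> = (\<lambda>j. {x. n j \<bullet> x = n j \<bullet> a}) ` {j. j \<noteq> k}"
  have "rational_hyperplane A" if "A \<in> \<H>" for A
  proof -
    obtain j where j: "j \<noteq> k" "A = {x. n j \<bullet> x = n j \<bullet> a}" using \<open>A \<in> \<H>\<close> by (auto simp: \<H>_def)
    have "n j $ j \<noteq> 0" using k by (simp add: n_def)
    then have "n j \<noteq> 0" by (metis zero_index)
    moreover have "\<And>i. n j $ i \<in> \<rat>" using u by (simp add: n_def)
    moreover have "n j \<bullet> a \<in> \<rat>" unfolding inner[OF j(1)] using a u by simp
    ultimately show ?thesis unfolding rational_hyperplane_def using j(2) by blast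
  qed
  moreover have "?L = \<Inter>\<H>"
  proof (intro equalityI subsetI)
    fix x assume "x \<in> ?L"
    then show "x \<in> \<Inter>\<H>" by (auto simp: \<H>_def inner algebra_simps)
  next
    fix x assume x: "x \<in> \<Inter>\<H>"
    define t where "t = (x $ k - a $ k) / u $ k"
    have "x $ j = (a + t *\<^sub>R u) $ j" for j
    proof (cases "j = k")
      case False
      then have "u $ k * x $ j - u $ j * x $ k = u $ k * a $ j - u $ j * a $ k"
        using x inner by (auto simp: \<H>_def)
      then show ?thesis using k by (simp add: t_def field_simps)
    qed (use k in \<open>simp add: t_def\<close>)
    then have "x = a + t *\<^sub>R u" by (simp add: vec_eq_iff)
    then show "x \<in> ?L" by blast
  qed
  ultimately show ?thesis unfolding rational_line_def using aff by blast
qed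

text \<open>A pigeonhole argument whose bound is independent of \<open>f\<close>. Two ranges of
  scales are stacked, below and above \<open>S\<close>: if \<open>f c\<close> for the new
  \<open>c\<close> is at most \<open>S\<close>, a scale from the upper range avoids it, and
  otherwise one from the lower range does.\<close>

lemma ex_scale_gap:
  fixes g :: "nat \<Rightarrow> nat"
  assumes "finite C" "\<And>K. K \<le> g K"
  shows "\<exists>S\<ge>M. \<forall>f. \<exists>K. M \<le> K \<and> g K \<le> S \<and> (\<forall>c\<in>C. f c \<le> real K \<or> real (g K) < f c)"
  using assms(1)
proof (induction C arbitrary: M)
  case empty
  then show ?case using assms(2) by (intro exI[of _ "g M"]) auto
next
  case (insert c C)
  obtain S where S: "M \<le> S" and 1: "\<And>f. \<exists>K. M \<le> K \<and> g K \<le> S \<and> (\<forall>c\<in>C. f c \<le> real K \<or> real (g K) < f c)"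
    using insert.IH[of M] by blast
  obtain S' where S': "S \<le> S'" and 2: "\<And>f. \<exists>K. S \<le> K \<and> g K \<le> S' \<and> (\<forall>c\<in>C. f c \<le> real K \<or> real (g K) < f c)"
    using insert.IH[of S] by blast
  show ?case
  proof (rule exI[of _ S'], intro conjI allI)
    show "M \<le> S'" using S S' by simp
    fix f :: "'a \<Rightarrow> real"
    show "\<exists>K. M \<le> K \<and> g K \<le> S' \<and> (\<forall>c\<in>insert c C. f c \<le> real K \<or> real (g K) < f c)"
    proof (cases "f c \<le> real S")
      case True
      obtain K where K: "S \<le> K" "g K \<le> S'" "\<forall>c\<in>C. f c \<le> real K \<or> real (g K) < f c" using 2 by blast
      then have "f c \<le> real K" using True by linarith
      then show ?thesis using K S by (intro exI[of _ K]) auto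
    next
      case False
      obtain K where K: "M \<le> K" "g K \<le> S" "\<forall>c\<in>C. f c \<le> real K \<or> real (g K) < f c" using 1 by blast
      then have "real (g K) < f c" using False by linarith
      then show ?thesis using K S' by (intro exI[of _ K]) auto
    qed
  qed
qed

text \<open>The direction \<open>w\<close> is the difference of \<open>a\<close> and a bounded representative of \<open>a\<close> at scale \<open>K\<close>:
  a form that is large at \<open>a\<close> compared to that bound is also large at \<open>w\<close>, and the choice of \<open>K\<close>
  leaves no forms in between.\<close>

lemma ex_direction:
  assumes "1 \<le> H"
  shows "\<exists>S\<ge>M. \<forall>a :: 'n::finite \<Rightarrow> real. \<exists>K (w :: 'n \<Rightarrow> int). M \<le> K \<and> K \<le> S \<and> (\<forall>c. small H c \<longrightarrow>
    (\<bar>lin UNIV c a\<bar> \<le> real K \<and> lin UNIV c (\<lambda>i. of_int (w i)) = 0) \<or>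
    (real K < lin UNIV c a \<and> 0 < lin UNIV c (\<lambda>i. of_int (w i))) \<or>
    (lin UNIV c a < - real K \<and> lin UNIV c (\<lambda>i. of_int (w i)) < 0))"
proof -
  \<comment> \<open>Modulus 1 makes the difference of \<open>a\<close> and its representative an
    integer vector, so forms take integer values on the direction.\<close>
  have "\<exists>R. \<forall>a :: 'n \<Rightarrow> real. \<exists>b. (\<forall>v\<in>UNIV. \<bar>b v\<bar> \<le> real R) \<and> eqv UNIV H K a b \<and> congr UNIV 1 a b" for K
    using assms by (intro bounded_rep) auto
  then obtain r where r: "\<And>K. \<forall>a :: 'n \<Rightarrow> real. \<exists>b. (\<forall>v\<in>UNIV. \<bar>b v\<bar> \<le> real (r K)) \<and> eqv UNIV H K a b \<and> congr UNIV 1 a b"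
    by metis
  define g where "g K = max K (CARD('n) * H * r K)" for K
  obtain S where S: "M \<le> S" and
    gap: "\<And>f. \<exists>K. M \<le> K \<and> g K \<le> S \<and> (\<forall>c\<in>{c :: 'n \<Rightarrow> int. small H c}. f c \<le> real K \<or> real (g K) < f c)"
    using ex_scale_gap[OF finite_small[of H], of g M] unfolding g_def by auto
  show ?thesis
  proof (rule exI[of _ S], intro conjI allI S)
    fix a :: "'n \<Rightarrow> real"
    obtain K where K: "M \<le> K" "g K \<le> S"
      and Kg: "\<And>c. small H c \<Longrightarrow> \<bar>lin UNIV c a\<bar> \<le> real K \<or> real (g K) < \<bar>lin UNIV c a\<bar>"
      using gap[of "\<lambda>c. \<bar>lin UNIV c a\<bar>"] by blast
    obtain b where b: "\<And>v. \<bar>b v\<bar> \<le> real (r K)" "eqv UNIV H K a b" "congr UNIV 1 a b"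
      using r by blast
    obtain w :: "'n \<Rightarrow> int" where w: "\<And>i. a i - b i = of_int (w i)"
      using b(3) unfolding congr_def by simp metis
    have lw: "lin UNIV c (\<lambda>i. of_int (w i)) = lin UNIV c a - lin UNIV c b" for c
      unfolding lin_diff w ..
    show "\<exists>K (w :: 'n \<Rightarrow> int). M \<le> K \<and> K \<le> S \<and> (\<forall>c. small H c \<longrightarrow>
      (\<bar>lin UNIV c a\<bar> \<le> real K \<and> lin UNIV c (\<lambda>i. of_int (w i)) = 0) \<or>
      (real K < lin UNIV c a \<and> 0 < lin UNIV c (\<lambda>i. of_int (w i))) \<or>
      (lin UNIV c a < - real K \<and> lin UNIV c (\<lambda>i. of_int (w i)) < 0))"
    proof (intro exI[of _ K] exI[of _ w] conjI allI impI)
      show "M \<le> K" "K \<le> S" using K by (auto simp: g_def)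
      fix c :: "'n \<Rightarrow> int" assume c: "small H c"
      have lb: "\<bar>lin UNIV c b\<bar> \<le> real CARD('n) * real H * real (r K)"
        by (rule abs_lin_le[OF _ c]) (use b(1) in auto)
      have "real CARD('n) * real H * real (r K) = real (CARD('n) * H * r K)" by simp
      then have "\<bar>lin UNIV c b\<bar> \<le> real (g K)" using lb unfolding g_def by linarith
      moreover have "real K \<le> real (g K)" by (simp add: g_def)
      moreover have "same K (lin UNIV c a) (lin UNIV c b)" using b(2) c by (simp add: eqv_def)
      ultimately show "(\<bar>lin UNIV c a\<bar> \<le> real K \<and> lin UNIV c (\<lambda>i. of_int (w i)) = 0) \<or>
        (real K < lin UNIV c a \<and> 0 < lin UNIV c (\<lambda>i. of_int (w i))) \<or>
        (lin UNIV c a < - real K \<and> lin UNIV c (\<lambda>i. of_int (w i)) < 0)"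
        using Kg[OF c] unfolding lw same_def by linarith
    qed
  qed
qed

subsection \<open>Sets that are tame on rational lines\<close>

text \<open>Along the ray from \<open>a\<close> in direction \<open>u = b - a + T w\<close> every form is constant or stays large, so \<open>X\<close>
  is periodic there; being eventually constant on a rational line, it is constant on the ray,
  and \<open>a + u\<close> is congruent to \<open>b\<close>.\<close>

lemma rational_points_agree:
  fixes X :: "(real ^ 'n) set" and a b :: "real ^ 'n" and w :: "'n \<Rightarrow> int"
  assumes inv: "\<And>a b. eqv UNIV H M (($) a) (($) b) \<Longrightarrow> congr UNIV N (($) a) (($) b) \<Longrightarrow> a \<in> X \<longleftrightarrow> b \<in> X"
    and N: "1 \<le> N" and lines: "\<And>L. rational_line L \<Longrightarrow> R1_definable (X \<inter> L)"
    and K: "M \<le> K"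
    and dir: "\<And>c. small H c \<Longrightarrow>
      (\<bar>lin UNIV c (($) a)\<bar> \<le> real K \<and> lin UNIV c (\<lambda>i. of_int (w i)) = 0) \<or>
      (real K < lin UNIV c (($) a) \<and> 0 < lin UNIV c (\<lambda>i. of_int (w i))) \<or>
      (lin UNIV c (($) a) < - real K \<and> lin UNIV c (\<lambda>i. of_int (w i)) < 0)"
    and ab: "eqv UNIV H K (($) a) (($) b)"
    and rat: "\<And>i. a $ i \<in> \<rat>" "\<And>i. b $ i \<in> \<rat>"
  shows "a \<in> X \<longleftrightarrow> b \<in> X"
proof -
  obtain B where B: "\<And>i. \<bar>b $ i - a $ i\<bar> \<le> real B"
    using ex_bound[OF finite, of UNIV "\<lambda>i. b $ i - a $ i"] by blast
  define D where "D = CARD('n) * H * B"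
  \<comment> \<open>Beyond \<open>D\<close>, the bound for small forms on \<open>b - a\<close>: as a
    nonzero form value on \<open>w\<close> is an integer, \<open>T * w\<close> outweighs
    \<open>b - a\<close>. The factor \<open>N\<close> makes \<open>T * w\<close> vanish modulo
    \<open>N\<close>, so that \<open>a + u\<close> is congruent to \<open>b\<close>.\<close>
  define T where "T = N * (D + 1)"
  define u :: "real ^ 'n" where "u = (\<chi> i. (b $ i - a $ i) + real T * of_int (w i))"
  have KM: "real M \<le> real K" using K by simp
  have "1 * (D + 1) \<le> T" unfolding T_def using N by (intro mult_le_mono) auto
  then have "real (1 * (D + 1)) \<le> real T" by (rule of_nat_mono)
  then have T: "real D + 1 \<le> real T" by simp
  have u: "($) u = (\<lambda>i. (b $ i - a $ i) + real T * of_int (w i))" by (auto simp: u_def)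
  have lin_u: "lin UNIV c (($) u) = lin UNIV c (($) b) - lin UNIV c (($) a) + real T * lin UNIV c (\<lambda>i. of_int (w i))"
    for c unfolding u lin_add lin_scale lin_diff ..
  have sab: "same K (lin UNIV c (($) a)) (lin UNIV c (($) b))" if "small H c" for c
    using ab that by (simp add: eqv_def)
  have region: "(\<bar>lin UNIV c (($) a)\<bar> \<le> real K \<and> lin UNIV c (($) u) = 0) \<or>
      (real K < lin UNIV c (($) a) \<and> 0 < lin UNIV c (($) u)) \<or>
      (lin UNIV c (($) a) < - real K \<and> lin UNIV c (($) u) < 0)" if c: "small H c" for c
  proof -
    have "\<bar>lin UNIV c (\<lambda>i. b $ i - a $ i)\<bar> \<le> real CARD('n) * real H * real B"
      by (rule abs_lin_le[OF finite c]) (rule B)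
    then have d: "\<bar>lin UNIV c (($) b) - lin UNIV c (($) a)\<bar> \<le> real D"
      unfolding lin_diff by (simp add: D_def)
    obtain k where k: "lin UNIV c (\<lambda>i. of_int (w i)) = of_int k"
      using lin_Ints[of UNIV c w] by (auto elim: Ints_cases)
    consider "\<bar>lin UNIV c (($) a)\<bar> \<le> real K" "k = 0" | "real K < lin UNIV c (($) a)" "k \<ge> 1"
      | "lin UNIV c (($) a) < - real K" "k \<le> -1"
      using dir[OF c] unfolding k by fastforce
    then show ?thesis
    proof cases
      case 1
      then show ?thesis using sab[OF c] unfolding lin_u k same_def by auto
    next
      case 2
      then have "real T * 1 \<le> real T * of_int k" by (intro mult_left_mono) auto
      then show ?thesis using 2 d T unfolding lin_u k by linarith
    next
      case 3
      then have "real T * of_int k \<le> real T * (-1)" by (intro mult_left_mono) auto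
      then show ?thesis using 3 d T unfolding lin_u k by linarith
    qed
  qed
  define x where "x t = a + t *\<^sub>R u" for t
  have xt: "($) (x t) = (\<lambda>i. a $ i + t * u $ i)" for t by (auto simp: x_def)
  have lin_x: "lin UNIV c (($) (x t)) = lin UNIV c (($) a) + t * lin UNIV c (($) u)" for c t
    unfolding xt lin_add lin_scale ..
  have seg: "eqv UNIV H M (($) (x t)) (($) (x t'))" if "0 \<le> t" "0 \<le> t'" for t t'
    unfolding eqv_def
  proof (intro allI impI)
    fix c :: "'n \<Rightarrow> int" assume "small H c"
    from region[OF this] show "same M (lin UNIV c (($) (x t))) (lin UNIV c (($) (x t')))"
    proof (elim disjE conjE)
      assume "lin UNIV c (($) u) = 0"
      then show ?thesis by (simp add: lin_x same_def)
    next
      assume *: "real K < lin UNIV c (($) a)" "0 < lin UNIV c (($) u)"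
      have "0 \<le> t * lin UNIV c (($) u)" "0 \<le> t' * lin UNIV c (($) u)" using * that by simp_all
      then show ?thesis using * KM unfolding lin_x same_def by linarith
    next
      assume *: "lin UNIV c (($) a) < - real K" "lin UNIV c (($) u) < 0"
      have "t * lin UNIV c (($) u) \<le> 0" "t' * lin UNIV c (($) u) \<le> 0"
        using * that by (simp_all add: mult_nonneg_nonpos)
      then show ?thesis using * KM unfolding lin_x same_def by linarith
    qed
  qed
  have ratu: "u $ i \<in> \<rat>" for i using rat by (simp add: u_def)
  obtain q where q: "q \<ge> 1" "\<And>i. real q * u $ i \<in> \<int>"
    using ex_common_denominator[OF finite, of UNIV "($) u"] ratu by auto
  \<comment> \<open>Since \<open>q * u\<close> is an integer vector, a step of \<open>N * q\<close>
    in \<open>t\<close> changes every coordinate by a multiple of \<open>N\<close>.\<close>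
  have period: "x t \<in> X \<longleftrightarrow> x (t + real (N * q)) \<in> X" if "0 \<le> t" for t
  proof (rule inv[OF seg[OF that]])
    show "congr UNIV N (($) (x t)) (($) (x (t + real (N * q))))"
      unfolding congr_def xt
    proof
      fix i
      obtain k where k: "real q * u $ i = of_int k" using q(2) by (auto elim: Ints_cases)
      have "a $ i + t * u $ i - (a $ i + (t + real (N * q)) * u $ i) = - (real N * (real q * u $ i))"
        by (simp add: algebra_simps)
      then have "a $ i + t * u $ i - (a $ i + (t + real (N * q)) * u $ i) = real N * of_int (- k)"
        unfolding k by simp
      then show "\<exists>k::int. a $ i + t * u $ i - (a $ i + (t + real (N * q)) * u $ i) = real N * of_int k" by blast
    qed
  qed (use that in simp)
  have periods: "x t \<in> X \<longleftrightarrow> x (t + real j * real (N * q)) \<in> X" if "0 \<le> t" for t j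
  proof (induction j)
    case (Suc j)
    have "0 \<le> t + real j * real (N * q)" using that by simp
    from period[OF this] Suc show ?case by (simp add: algebra_simps)
  qed simp
  have "x 0 \<in> X \<longleftrightarrow> x 1 \<in> X"
  proof (cases "u = 0")
    case False
    have L: "rational_line (range x)"
      unfolding x_def[abs_def] by (rule rational_line_param[OF rat(1) ratu False])
    obtain H' where H': "\<And>y z. sgneq UNIV H' (($) y) (($) z) \<Longrightarrow> y \<in> X \<inter> range x \<longleftrightarrow> z \<in> X \<inter> range x"
      using R1_definable_sgneq[OF lines[OF L]] by blast
    obtain t0 where t0: "\<And>t t'. t0 \<le> t \<Longrightarrow> t0 \<le> t' \<Longrightarrow> sgneq UNIV H' (($) (x t)) (($) (x t'))"
      using sgneq_ray[of H' "($) a" "($) u"] unfolding xt by blast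
    obtain j where j: "t0 \<le> real j" using real_arch_simple by blast
    have "j * 1 \<le> j * (N * q)" using N q(1) by (intro mult_le_mono) auto
    then have "real j \<le> real j * real (N * q)" by (metis mult_1_right of_nat_mono of_nat_mult)
    then have j: "t0 \<le> 0 + real j * real (N * q)" "t0 \<le> 1 + real j * real (N * q)" using j by linarith+
    from H'[OF t0[OF this]] periods[of 0 j] periods[of 1 j] show ?thesis by simp
  qed (simp add: x_def)
  moreover have "b \<in> X \<longleftrightarrow> x 1 \<in> X"
  proof (rule inv)
    show "congr UNIV N (($) b) (($) (x 1))"
      unfolding congr_def xt
    proof
      fix i
      have "b $ i - (a $ i + 1 * u $ i) = real N * of_int (- (int (D + 1) * w i))"
        by (simp add: u_def T_def algebra_simps)
      then show "\<exists>k::int. b $ i - (a $ i + 1 * u $ i) = real N * of_int k" by blast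
    qed
    show "eqv UNIV H M (($) b) (($) (x 1))"
      using eqv_trans[OF eqv_sym[OF eqv_mono[OF ab order_refl K]], of "($) (x 1)"] seg[of 0 1]
      by (simp add: x_def)
  qed
  ultimately show ?thesis by (simp add: x_def)
qed

section \<open>Pairs of points as one assignment, and the passage to rational points\<close>

lemma lin_case_sum:
  "lin (UNIV :: ('a::finite + 'b::finite) set) (case_sum c d) (case_sum f g) = lin UNIV c f + lin UNIV d g"
  unfolding lin_def UNIV_Plus_UNIV[symmetric] by (subst sum.Plus) auto

lemma small_case_sum: "small H c \<Longrightarrow> small H d \<Longrightarrow> small H (case_sum c d)"
  by (auto simp: small_def split: sum.split)

lemma sgneq_case_sumD:
  assumes "sgneq (UNIV :: ('a::finite + 'b::finite) set) H (case_sum f g) (case_sum f' g')"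
  shows "sgneq UNIV H f f'" "sgneq UNIV H g g'"
  unfolding sgneq_def
proof (safe)
  fix c :: "'a \<Rightarrow> int" and d :: int assume "small H c" "\<bar>d\<bar> \<le> int H"
  then show "sgn (lin UNIV c f + of_int d) = sgn (lin UNIV c f' + of_int d)"
    using sgneqD[OF assms small_case_sum[of H c "\<lambda>_. 0"]] by (simp add: lin_case_sum)
next
  fix c :: "'b \<Rightarrow> int" and d :: int assume "small H c" "\<bar>d\<bar> \<le> int H"
  then show "sgn (lin UNIV c g + of_int d) = sgn (lin UNIV c g' + of_int d)"
    using sgneqD[OF assms small_case_sum[of H "\<lambda>_. 0" c]] by (simp add: lin_case_sum)
qed

text \<open>Equality of a form at \<open>f\<close> and at \<open>g\<close> is not visible in the
  signs at each point alone. For the pair, read as one assignment, it is the sign of the form with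
  coefficients \<open>c\<close> and \<open>- c\<close>; the comparisons with \<open>S\<close> and
  \<open>- S\<close> are signs at the single points.\<close>

lemma eqv_transfer:
  fixes f g f' g' :: "'n::finite \<Rightarrow> real"
  assumes sg: "sgneq UNIV K (case_sum f g) (case_sum f' g')" and "H \<le> K" "S \<le> K"
    and fg: "eqv UNIV H S f g"
  shows "eqv UNIV H S f' g'"
  unfolding eqv_def
proof (intro allI impI)
  fix c :: "'n \<Rightarrow> int" assume "small H c"
  then have same: "same S (lin UNIV c f) (lin UNIV c g)" and c: "small K c"
    using fg small_mono \<open>H \<le> K\<close> by (auto simp: eqv_def)
  have "sgn (lin UNIV c f - lin UNIV c g) = sgn (lin UNIV c f' - lin UNIV c g')"
    using sgneqD[OF sg small_case_sum[OF c small_uminus[OF c]], of 0] by (simp add: lin_case_sum lin_uminus)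
  note 1 = sgn_eq_iff(1)[OF this]
  have 2: "sgn (lin UNIV c f + of_int d) = sgn (lin UNIV c f' + of_int d)"
    "sgn (lin UNIV c g + of_int d) = sgn (lin UNIV c g' + of_int d)" if "\<bar>d\<bar> \<le> int K" for d
    using sgneq_case_sumD[OF sg] sgneqD c that by blast+
  have d: "\<bar>int S\<bar> \<le> int K" "\<bar>- int S\<bar> \<le> int K" using \<open>S \<le> K\<close> by auto
  note 3 = 2[OF d(1), THEN sgn_eq_iff(2)] 2[OF d(2), THEN sgn_eq_iff(3)]
  show "same S (lin UNIV c f') (lin UNIV c g')" using same 1 3 unfolding same_def by auto
qed

lemma sgneq_bounded:
  fixes f f' :: "'n::finite \<Rightarrow> real"
  assumes "sgneq UNIV H f f'" "R \<le> H" "1 \<le> H" "\<And>i. \<bar>f i\<bar> \<le> real R"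
  shows "\<bar>f' i\<bar> \<le> real R"
  using sgneq_abs_le[OF _ _ assms(1-3), of i] assms(4) by simp

text \<open>The two bounded representatives have to be made rational jointly, as a single assignment
  on \<open>'n + 'n\<close>; choosing a rational point for each separately could destroy their
  equivalence.\<close>

lemma eqv_invariant:
  fixes X :: "(real ^ 'n) set"
  assumes X: "RZ_definable X" and lines: "\<And>L. rational_line L \<Longrightarrow> R1_definable (X \<inter> L)"
  shows "\<exists>H S. 1 \<le> H \<and> (\<forall>a b. eqv UNIV H S (($) a) (($) b) \<longrightarrow> (a \<in> X \<longleftrightarrow> b \<in> X))"
proof -
  obtain H M N where HN: "1 \<le> H" "1 \<le> N" and inv: "\<And>a b. eqv UNIV H M (($) a) (($) b) \<Longrightarrow>
      congr UNIV N (($) a) (($) b) \<Longrightarrow> a \<in> X \<longleftrightarrow> b \<in> X"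
    using RZ_definable_invariant[OF X] by blast
  obtain S where S: "M \<le> S" and dir: "\<And>a :: 'n \<Rightarrow> real. \<exists>K (w :: 'n \<Rightarrow> int). M \<le> K \<and> K \<le> S \<and> (\<forall>c. small H c \<longrightarrow>
    (\<bar>lin UNIV c a\<bar> \<le> real K \<and> lin UNIV c (\<lambda>i. of_int (w i)) = 0) \<or>
    (real K < lin UNIV c a \<and> 0 < lin UNIV c (\<lambda>i. of_int (w i))) \<or>
    (lin UNIV c a < - real K \<and> lin UNIV c (\<lambda>i. of_int (w i)) < 0))"
    using ex_direction[OF HN(1), where 'n = 'n] by meson
  obtain R where R: "\<And>a :: 'n \<Rightarrow> real. \<exists>b. (\<forall>v\<in>UNIV. \<bar>b v\<bar> \<le> real R) \<and> eqv UNIV H S a b \<and> congr UNIV N a b"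
    using bounded_rep[OF finite HN] by blast
  obtain HB where HB: "\<And>a b. (\<forall>i. \<bar>a $ i\<bar> \<le> real R \<and> \<bar>b $ i\<bar> \<le> real R) \<Longrightarrow>
      sgneq UNIV HB (($) a) (($) b) \<Longrightarrow> a \<in> X \<longleftrightarrow> b \<in> X"
    using RZ_definable_bounded_sgneq[OF X] by blast
  define Q where "Q = HB + H + S + R"
  have Q: "HB \<le> Q" "H \<le> Q" "S \<le> Q" "R \<le> Q" "1 \<le> Q" using HN by (auto simp: Q_def)
  have rational: "\<exists>e'. sgneq UNIV Q e e' \<and> (\<forall>v. e' v \<in> \<rat>)" for e :: "'n + 'n \<Rightarrow> real"
  proof -
    obtain H' where "\<And>a b. sgneq {} H' a b \<Longrightarrow> \<exists>b'. sgneq ({} \<union> UNIV) Q a b' \<and> (\<forall>u\<in>{} \<union> (UNIV :: ('n + 'n) set). b' u \<in> \<rat>)"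
      using sgneq_extend[of "{}" "UNIV :: ('n + 'n) set" Q] by auto
    moreover have "sgneq {} H' e e" by (simp add: sgneq_def)
    ultimately show ?thesis by fastforce
  qed
  have "a \<in> X \<longleftrightarrow> b \<in> X" if ab: "eqv UNIV H S (($) a) (($) b)" for a b
  proof -
    obtain f where f: "\<And>i. \<bar>f i\<bar> \<le> real R" "eqv UNIV H S (($) a) f" "congr UNIV N (($) a) f" using R by blast
    obtain g where g: "\<And>i. \<bar>g i\<bar> \<le> real R" "eqv UNIV H S (($) b) g" "congr UNIV N (($) b) g" using R by blast
    define a1 b1 where "a1 = vec_lambda f" and "b1 = vec_lambda g"
    have f1: "($) a1 = f" "($) b1 = g" by (auto simp: a1_def b1_def)
    have 1: "a \<in> X \<longleftrightarrow> a1 \<in> X" "b \<in> X \<longleftrightarrow> b1 \<in> X"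
      using f g by (auto intro!: inv eqv_mono[OF _ order_refl S] simp: f1)
    have fg: "eqv UNIV H S f g" using eqv_trans[OF eqv_sym[OF f(2)] eqv_trans[OF ab g(2)]] .
    obtain e where e: "sgneq UNIV Q (case_sum f g) e" "\<And>v. e v \<in> \<rat>" using rational by blast
    define f' g' where "f' = e \<circ> Inl" and "g' = e \<circ> Inr"
    have "e = case_sum f' g'" by (auto simp: f'_def g'_def fun_eq_iff split: sum.split)
    then have e': "sgneq UNIV Q (case_sum f g) (case_sum f' g')" using e(1) by simp
    define a2 b2 where "a2 = vec_lambda f'" and "b2 = vec_lambda g'"
    have f2: "($) a2 = f'" "($) b2 = g'" by (auto simp: a2_def b2_def)
    note sg = sgneq_case_sumD[OF e']
    have "\<bar>f' i\<bar> \<le> real R" "\<bar>g' i\<bar> \<le> real R" for i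
      using sgneq_bounded[OF sg(1) Q(4,5) f(1)] sgneq_bounded[OF sg(2) Q(4,5) g(1)] by auto
    then have 2: "a1 \<in> X \<longleftrightarrow> a2 \<in> X" "b1 \<in> X \<longleftrightarrow> b2 \<in> X"
      using HB[of a1 a2] HB[of b1 b2] f(1) g(1) sgneq_mono[OF sg(1) Q(1)] sgneq_mono[OF sg(2) Q(1)]
      by (simp_all add: f1 f2)
    have fg': "eqv UNIV H S (($) a2) (($) b2)" using eqv_transfer[OF e' Q(2,3) fg] by (simp add: f2)
    \<comment> \<open>The scale \<open>K\<close> depends on \<open>a2\<close>. Because
      \<open>K \<le> S\<close>, equivalence at the uniform scale \<open>S\<close> implies
      equivalence at scale \<open>K\<close>, and \<open>M \<le> K\<close> is what invariance along
      the ray needs.\<close>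
    obtain K and w :: "'n \<Rightarrow> int" where K: "M \<le> K" "K \<le> S" and w: "\<And>c. small H c \<Longrightarrow>
      (\<bar>lin UNIV c (($) a2)\<bar> \<le> real K \<and> lin UNIV c (\<lambda>i. of_int (w i)) = 0) \<or>
      (real K < lin UNIV c (($) a2) \<and> 0 < lin UNIV c (\<lambda>i. of_int (w i))) \<or>
      (lin UNIV c (($) a2) < - real K \<and> lin UNIV c (\<lambda>i. of_int (w i)) < 0)"
      using dir[of "($) a2"] by blast
    have "a2 $ i \<in> \<rat>" "b2 $ i \<in> \<rat>" for i using e(2) by (simp_all add: f2 f'_def g'_def)
    then have "a2 \<in> X \<longleftrightarrow> b2 \<in> X"
      using rational_points_agree[OF inv HN(2) lines K(1) w eqv_mono[OF fg' order_refl K(2)]] by blast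
    then show ?thesis using 1 2 by simp
  qed
  then show ?thesis using HN(1) by blast
qed

text \<open>A bounded \<open>f\<close> equivalent to \<open>a\<close> is treated as an existential
  witness: sign equivalence of \<open>a\<close> and \<open>b\<close> at a sufficiently large
  \<open>H'\<close> yields a \<open>g\<close> that is related to \<open>b\<close> as
  \<open>f\<close> is to \<open>a\<close>, is bounded by the same \<open>R\<close>, and is
  sign-equivalent to \<open>f\<close>.\<close>

lemma R1_definable_if_lines:
  fixes X :: "(real ^ 'n) set"
  assumes X: "RZ_definable X" and lines: "\<And>L. rational_line L \<Longrightarrow> R1_definable (X \<inter> L)"
  shows "R1_definable X"
proof -
  obtain H S where H: "1 \<le> H" and inv: "\<And>a b. eqv UNIV H S (($) a) (($) b) \<Longrightarrow> a \<in> X \<longleftrightarrow> b \<in> X"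
    using eqv_invariant[OF assms] by blast
  obtain R where R: "\<And>a :: 'n \<Rightarrow> real. \<exists>b. (\<forall>v\<in>UNIV. \<bar>b v\<bar> \<le> real R) \<and> eqv UNIV H S a b \<and> congr UNIV 1 a b"
    using bounded_rep[OF finite H order_refl] by blast
  obtain HB where HB: "\<And>a b. (\<forall>i. \<bar>a $ i\<bar> \<le> real R \<and> \<bar>b $ i\<bar> \<le> real R) \<Longrightarrow>
      sgneq UNIV HB (($) a) (($) b) \<Longrightarrow> a \<in> X \<longleftrightarrow> b \<in> X"
    using RZ_definable_bounded_sgneq[OF X] by blast
  define Q where "Q = HB + H + S + R"
  have Q: "HB \<le> Q" "H \<le> Q" "S \<le> Q" "R \<le> Q" "1 \<le> Q" using H by (auto simp: Q_def)
  obtain H' where ext: "\<forall>a b :: 'n + 'n \<Rightarrow> real. sgneq (range Inl) H' a b \<longrightarrow>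
      (\<exists>b'. (\<forall>u\<in>range Inl. b' u = b u) \<and> sgneq (range Inl \<union> UNIV) Q a b' \<and>
        ((\<forall>u\<in>range Inl. b u \<in> \<rat>) \<longrightarrow> (\<forall>u\<in>range Inl \<union> UNIV. b' u \<in> \<rat>)))"
    using sgneq_extend[OF finite finite] by blast
  show ?thesis
  proof (rule R1_definable_if_sgneq)
    fix a b :: "real ^ 'n" assume ab: "sgneq UNIV H' (($) a) (($) b)"
    obtain f where f: "\<And>i. \<bar>f i\<bar> \<le> real R" "eqv UNIV H S (($) a) f" using R by blast
    obtain e where e: "\<forall>u\<in>range Inl. e u = case_sum (($) b) (\<lambda>_. 0) u"
      "sgneq (range Inl \<union> UNIV) Q (case_sum (($) a) f) e"
      using ext[rule_format, OF sgneq_Inl[OF ab]] by blast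
    define g where "g = e \<circ> Inr"
    have "e = case_sum (($) b) g" using e(1) by (auto simp: g_def fun_eq_iff split: sum.split)
    then have sg: "sgneq UNIV Q (case_sum (($) a) f) (case_sum (($) b) g)" using e(2) by simp
    define a1 b1 where "a1 = vec_lambda f" and "b1 = vec_lambda g"
    have f1: "($) a1 = f" "($) b1 = g" by (auto simp: a1_def b1_def)
    note sg' = sgneq_case_sumD(2)[OF sg]
    have "a \<in> X \<longleftrightarrow> a1 \<in> X" using inv f(2) by (simp add: f1)
    also have "\<dots> \<longleftrightarrow> b1 \<in> X"
      using HB[of a1 b1] f(1) sgneq_bounded[OF sg' Q(4,5) f(1)] sgneq_mono[OF sg' Q(1)] by (simp add: f1)
    also have "\<dots> \<longleftrightarrow> b \<in> X" using inv[of b b1] eqv_transfer[OF sg Q(2,3) f(2)] by (simp add: f1)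
    finally show "a \<in> X \<longleftrightarrow> b \<in> X" .
  qed
qed

theorem theorem8p1:
  fixes X :: "(real ^ 'n) set"
  assumes "RZ_definable X"
  shows "R1_definable X \<longleftrightarrow> (\<forall>L. rational_line L \<longrightarrow> R1_definable (X \<inter> L))"
  using R1_definable_if_lines[OF assms] definable_Int R1_definable_rational_line by blast

end
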